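(* Let $\mathcal{C}$ be the set of convex regions of $\mathbb{E}^n$. Over $\mathcal{C}$, the homeomorphism metric $M$, the Hausdorff metric $H$, the dual-Hausdorff metric $H^d$, the symmetric-difference metric $V$, and every Wasserstein metric $W^\psi$ ($\psi$ any Mulholland function) all generate the same topology.
   Context: Fix $n\ge 2$; $\mathbb{E}^n$ is $n$-dimensional Euclidean space with distance $d$; $v$ is $n$-dimensional volume. A region is a nonempty bounded open subset of $\mathbb{E}^n$ equal to the interior of its closure. $P^c$ is the complement of $P$. Homeomorphism metric: $M(A,B)=\inf_{\gamma}\sup_{x\in\mathbb{E}^n}d(x,\gamma(x))$, the infimum over all homeomorphisms $\gamma$ of $\mathbb{E}^n$ to itself with $\gamma(A)=B$ ($M(A,B)=\infty$ if there are none). Hausdorff metric: for sets $P,Q$, $d(p,Q)=\min_{q\in\bar Q}d(p,q)$, $H^1(P,Q)=\sup_{p\in P}d(p,Q)$, $H(P,Q)=\max(H^1(P,Q),H^1(Q,P))$. Dual-Hausdorff metric: $H^d(P,Q)=\max(H(P,Q),H(Q^c,P^c))$. Symmetric-difference metric: $V(P,Q)=v((P\setminus Q)\cup(Q\setminus P))$. Mulholland function: a continuous, (strictly) increasing $\psi:\mathbb{R}^{\ge0}\to\mathbb{R}^{\ge0}$ with $\psi(0)=0$, $\lim_{x\to\infty}\psi(x)=\infty$, and $\psi^{-1}(\sum_{i=1}^m\psi(x_i+y_i))\le\psi^{-1}(\sum_{i=1}^m\psi(x_i))+\psi^{-1}(\sum_{i=1}^m\psi(y_i))$ for all $m$ and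 all $x_i,y_i\ge0$. Wasserstein metric: for a region $P$ let $U_P$ be the uniform probability distribution on $P$. For regions $P,Q$, $W^\psi(P,Q)=\inf_\gamma\psi^{-1}\left(\frac{1}{v(P)}\int_P\psi(d(x,\gamma(x)))\,dx\right)$, the infimum over all (measurable) functions $\gamma$ such that if a random variable $X$ has distribution $U_P$ then $\gamma(X)$ has distribution $U_Q$. *)

theory Defs
  imports "HOL-Analysis.Analysis"
begin

text \<open>
  Distances take values in \<^typ>\<open>ennreal\<close>, since infima over empty sets and suprema over
  unbounded sets are to be read as infinity.  The following is \<^const>\<open>Metric_space.mtopology\<close>
  for such distances; the lemma \<open>dist_topology_eq_mtopology\<close> below shows that the two agree.
\<close>

definition dist_topology :: "'p set \<Rightarrow> ('p \<Rightarrow> 'p \<Rightarrow> ennreal) \<Rightarrow> 'p topology" where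
  "dist_topology C D =
     topology (\<lambda>U. U \<subseteq> C \<and> (\<forall>P\<in>U. \<exists>r>0. {Q \<in> C. D P Q < ennreal r} \<subseteq> U))"

lemma istopology_dist_topology:
  "istopology (\<lambda>U. U \<subseteq> C \<and> (\<forall>P\<in>U. \<exists>r>0. {Q \<in> C. D P Q < ennreal r} \<subseteq> U))"
  (is "istopology ?L")
proof -
  have "?L (S \<inter> T)" if S: "?L S" and T: "?L T" for S T
  proof (intro conjI ballI)
    show "S \<inter> T \<subseteq> C" using S by blast
    fix P assume P: "P \<in> S \<inter> T"
    obtain r where r: "r > 0" "{Q \<in> C. D P Q < ennreal r} \<subseteq> S"
      using S P by (meson IntD1)
    obtain s where s: "s > 0" "{Q \<in> C. D P Q < ennreal s} \<subseteq> T"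
      using T P by (meson IntD2)
    have le: "ennreal (min r s) \<le> ennreal r" "ennreal (min r s) \<le> ennreal s"
      by (simp_all add: ennreal_leI)
    have "Q \<in> S \<inter> T" if "Q \<in> C" "D P Q < ennreal (min r s)" for Q
      using order.strict_trans2[OF that(2) le(1)] order.strict_trans2[OF that(2) le(2)]
        that(1) r(2) s(2) by blast
    then have "{Q \<in> C. D P Q < ennreal (min r s)} \<subseteq> S \<inter> T" by blast
    moreover have "min r s > 0" using r(1) s(1) by simp
    ultimately show "\<exists>r>0. {Q \<in> C. D P Q < ennreal r} \<subseteq> S \<inter> T" by blast
  qed
  moreover have "?L (\<Union>K)" if K: "\<forall>U\<in>K. ?L U" for K
  proof (intro conjI ballI)
    show "\<Union>K \<subseteq> C" using K by blast
    fix P assume "P \<in> \<Union>K"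
    then obtain U where U: "U \<in> K" "P \<in> U" by blast
    then obtain r where "r > 0" "{Q \<in> C. D P Q < ennreal r} \<subseteq> U"
      using K by meson
    with U show "\<exists>r>0. {Q \<in> C. D P Q < ennreal r} \<subseteq> \<Union>K"
      by (meson Union_upper order_trans)
  qed
  ultimately show ?thesis
    unfolding istopology_def by (intro conjI allI impI) simp_all
qed

lemma openin_dist_topology:
  "openin (dist_topology C D) U \<longleftrightarrow>
     U \<subseteq> C \<and> (\<forall>P\<in>U. \<exists>r>0. {Q \<in> C. D P Q < ennreal r} \<subseteq> U)"
  unfolding dist_topology_def
  by (simp add: topology_inverse'[OF istopology_dist_topology])

lemma (in Metric_space) dist_topology_eq_mtopology:
  "dist_topology M (\<lambda>x y. ennreal (d x y)) = mtopology"
proof -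
  have "{y \<in> M. ennreal (d x y) < ennreal r} = mball x r" if "x \<in> M" for x r
    using that by (auto simp: ennreal_less_iff)
  then have "U \<subseteq> M \<and> (\<forall>x\<in>U. \<exists>r>0. {y \<in> M. ennreal (d x y) < ennreal r} \<subseteq> U) \<longleftrightarrow>
      U \<subseteq> M \<and> (\<forall>x. x \<in> U \<longrightarrow> (\<exists>r>0. mball x r \<subseteq> U))" for U
    by (metis subsetD)
  then show ?thesis
    unfolding topology_eq openin_dist_topology openin_mtopology by blast
qed

definition region :: "'a::euclidean_space set \<Rightarrow> bool" where
  "region P \<longleftrightarrow> P \<noteq> {} \<and> bounded P \<and> open P \<and> P = interior (closure P)"

definition convex_regions :: "'a::euclidean_space set set" where
  "convex_regions = {P. region P \<and> convex P}"

definition homeo_dist :: "'a::euclidean_space set \<Rightarrow> 'a set \<Rightarrow> ennreal" where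
  "homeo_dist A B =
     (INF \<gamma> \<in> {\<gamma>. (\<exists>\<delta>. homeomorphism UNIV UNIV \<gamma> \<delta>) \<and> \<gamma> ` A = B}. SUP x. ennreal (dist x (\<gamma> x)))"

definition hausdorff_semidist :: "'a::euclidean_space set \<Rightarrow> 'a set \<Rightarrow> ennreal" where
  "hausdorff_semidist P Q = (SUP p\<in>P. ennreal (infdist p (closure Q)))"

definition hausdorff_dist :: "'a::euclidean_space set \<Rightarrow> 'a set \<Rightarrow> ennreal" where
  "hausdorff_dist P Q = max (hausdorff_semidist P Q) (hausdorff_semidist Q P)"

definition dual_hausdorff_dist :: "'a::euclidean_space set \<Rightarrow> 'a set \<Rightarrow> ennreal" where
  "dual_hausdorff_dist P Q = max (hausdorff_dist P Q) (hausdorff_dist (- Q) (- P))"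

definition symdiff_dist :: "'a::euclidean_space set \<Rightarrow> 'a set \<Rightarrow> ennreal" where
  "symdiff_dist P Q = emeasure lborel ((P - Q) \<union> (Q - P))"

text \<open>
  A function on the nonnegative reals is represented by a function on \<^typ>\<open>real\<close> of which
  only the values on \<open>{0..}\<close> are used; its inverse is \<open>inv_into {0..} \<psi>\<close>.
\<close>

definition mulholland :: "(real \<Rightarrow> real) \<Rightarrow> bool" where
  "mulholland \<psi> \<longleftrightarrow>
     \<psi> ` {0..} \<subseteq> {0..} \<and> continuous_on {0..} \<psi> \<and> strict_mono_on {0..} \<psi> \<and> \<psi> 0 = 0 \<and>
     filterlim \<psi> at_top at_top \<and>
     (\<forall>(m::nat) x y. (\<forall>i<m. 0 \<le> x i \<and> 0 \<le> y i) \<longrightarrow>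
        inv_into {0..} \<psi> (\<Sum>i<m. \<psi> (x i + y i))
          \<le> inv_into {0..} \<psi> (\<Sum>i<m. \<psi> (x i)) + inv_into {0..} \<psi> (\<Sum>i<m. \<psi> (y i)))"

definition transport_maps :: "'a::euclidean_space set \<Rightarrow> 'a set \<Rightarrow> ('a \<Rightarrow> 'a) set" where
  "transport_maps P Q =
     {\<gamma> \<in> borel_measurable borel.
        distr (uniform_measure lborel P) lborel \<gamma> = uniform_measure lborel Q}"

text \<open>
  For regions and a transport map the integrand is measurable and essentially bounded
  (almost every point of \<open>P\<close> is sent into the bounded set \<open>Q\<close>), so the Bochner integral is the
  integral in the usual sense and no infinite value is lost.
\<close>

definition wasserstein_dist ::
    "(real \<Rightarrow> real) \<Rightarrow> 'a::euclidean_space set \<Rightarrow> 'a set \<Rightarrow> ennreal" where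
  "wasserstein_dist \<psi> P Q =
     (INF \<gamma> \<in> transport_maps P Q.
        ennreal (inv_into {0..} \<psi>
          (1 / measure lborel P * (LINT x:P|lborel. \<psi> (dist x (\<gamma> x))))))"

end

theory Submission
  imports Defs
begin

text \<open>
  Fix a convex region \<open>P\<close> and an inner point \<open>c\<close>.  Each distance is compared with the condition that
  \<open>Q\<close> lies between the dilates of \<open>P\<close> about \<open>c\<close> with factors \<open>1 - t\<close> and \<open>1 + t\<close>.  If this fails, then
  separation produces a ball, of radius depending only on \<open>P\<close> and \<open>t\<close>, inside one of the two sets and
  far from the other, which bounds \<open>H\<close>, \<open>V\<close> and \<open>W\<close> from below.  If it holds, a radial
  homeomorphism moves all points by \<open>O(t)\<close>, the symmetric difference has volume \<open>O(t)\<close>, and a cheap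
  transport map is obtained by dilating \<open>P\<close> to the volume of \<open>Q\<close>, leaving the overlap with \<open>Q\<close> fixed
  and moving the small rest by piecewise translations.  Finally \<open>H \<le> H\<^sup>d \<le> M\<close>.
\<close>

section \<open>Comparison of distances\<close>

text \<open>All estimates are local: P is fixed and Q varies, so constants may depend on P, on c and
  on an inner and an outer radius, and no uniformity over convex regions is required. The test
  object for the lower bounds is a ball and not a point, because only a ball has a volume that
  \<open>symdiff_dist\<close> and \<open>wasserstein_dist\<close> can notice; convexity turns a
  misplaced point into such a ball. The obstacle to the upper bounds is that
  \<open>wasserstein_dist\<close> ranges over maps and not over couplings: the part of the dilated P
  that sticks out of Q has to be carried, by one measurable map and with exact preservation of
  volume, to the part of Q left uncovered. Hence the dilation to the volume of Q, which makes the
  two parts equally large, and hence the exhaustion by translations. How far this rest moves hardly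
  matters, since a bounded displacement times a small volume is small. For \<open>homeo_dist\<close>
  the displacement must be small at every point, also far from P, where scaling would move points
  too far. \<open>dual_hausdorff_dist\<close> needs no estimate of its own, being squeezed between
  two equivalent distances.\<close>

lemma openin_dist_topology_transfer:
  assumes "openin (dist_topology C D) U"
    and "\<And>P r. P \<in> C \<Longrightarrow> r > 0 \<Longrightarrow> \<exists>s>0. \<forall>Q\<in>C. D' P Q < ennreal s \<longrightarrow> D P Q < ennreal r"
  shows "openin (dist_topology C D') U"
  unfolding openin_dist_topology
proof (intro conjI ballI)
  show UC: "U \<subseteq> C"
    using assms(1) by (simp add: openin_dist_topology)
  fix P assume P: "P \<in> U"
  then obtain r where r: "r > 0" "{Q \<in> C. D P Q < ennreal r} \<subseteq> U"
    using assms(1) unfolding openin_dist_topology by meson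
  obtain s where "s > 0" "\<forall>Q\<in>C. D' P Q < ennreal s \<longrightarrow> D P Q < ennreal r"
    using assms(2) UC P r(1) by blast
  then show "\<exists>s>0. {Q \<in> C. D' P Q < ennreal s} \<subseteq> U"
    using r(2) by blast
qed

lemma hausdorff_le_dual: "hausdorff_dist P Q \<le> dual_hausdorff_dist P Q"
  by (simp add: dual_hausdorff_dist_def)

lemma hausdorff_semidist_le:
  assumes "\<And>p. p \<in> P \<Longrightarrow> \<exists>q\<in>Q. ennreal (dist p q) \<le> s"
  shows "hausdorff_semidist P Q \<le> s"
  unfolding hausdorff_semidist_def
proof (rule SUP_least)
  fix p assume "p \<in> P"
  then obtain q where q: "q \<in> Q" "ennreal (dist p q) \<le> s"
    using assms by blast
  have "infdist p (closure Q) \<le> dist p q"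
    using q(1) closure_subset by (intro infdist_le) auto
  then show "ennreal (infdist p (closure Q)) \<le> s"
    using q(2) by (meson ennreal_leI order_trans)
qed

text \<open>A bijection that carries P to Q also carries the complement of P to that of Q, so the
  pairs of x and \<open>\<gamma> x\<close> are witnesses for all four semidistances.\<close>

lemma dual_hausdorff_le_homeo:
  fixes P Q :: "'a::euclidean_space set"
  shows "dual_hausdorff_dist P Q \<le> homeo_dist P Q"
  unfolding homeo_dist_def
proof (rule INF_greatest, safe)
  fix \<gamma> \<delta> :: "'a \<Rightarrow> 'a" assume h: "homeomorphism UNIV UNIV \<gamma> \<delta>"
  have inj: "inj \<gamma>"
    using h by (metis UNIV_I homeomorphism_apply1 injI)
  have surj: "surj \<gamma>"
    using h by (auto simp: homeomorphism_def)
  let ?s = "SUP x. ennreal (dist x (\<gamma> x))"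
  have le: "ennreal (dist x (\<gamma> x)) \<le> ?s" "ennreal (dist (\<gamma> x) x) \<le> ?s" for x
    by (auto simp: dist_commute intro: SUP_upper)
  have "- (\<gamma> ` P) = \<gamma> ` (- P)"
    using inj surj by (simp add: bij_def bij_image_Compl_eq)
  moreover have "hausdorff_semidist A (\<gamma> ` A) \<le> ?s" "hausdorff_semidist (\<gamma> ` A) A \<le> ?s" for A
    using le by (auto intro!: hausdorff_semidist_le)
  ultimately show "dual_hausdorff_dist P (\<gamma> ` P) \<le> ?s"
    by (simp add: dual_hausdorff_dist_def hausdorff_dist_def)
qed

section \<open>Sandwiching between dilates\<close>

definition dilate :: "'a::real_vector \<Rightarrow> real \<Rightarrow> 'a \<Rightarrow> 'a" where
  "dilate c s x = c + s *\<^sub>R (x - c)"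

definition sandwiched :: "'a::real_vector \<Rightarrow> real \<Rightarrow> 'a set \<Rightarrow> 'a set \<Rightarrow> bool" where
  "sandwiched c t P Q \<longleftrightarrow> dilate c (1 - t) ` P \<subseteq> Q \<and> Q \<subseteq> dilate c (1 + t) ` P"

text \<open>With a unit normal, a gap between inner products is a lower bound for a distance; see
  \<open>dist_ge_inner_gap\<close>.\<close>

lemma separating_unit_normal:
  fixes Q :: "'a::euclidean_space set"
  assumes "convex Q" "x \<notin> Q"
  obtains u where "norm u = 1" "\<And>z. z \<in> Q \<Longrightarrow> u \<bullet> z \<le> u \<bullet> x"
proof (cases "Q = {}")
  case True
  obtain b :: 'a where "b \<in> Basis" using nonempty_Basis by blast
  then show ?thesis using that[of b] True by simp
next
  case False
  then obtain a b where ab: "a \<noteq> 0" "\<forall>y\<in>{x}. a \<bullet> y \<le> b" "\<forall>y\<in>Q. b \<le> a \<bullet> y"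
    using separating_hyperplane_sets[of "{x}" Q] assms by auto
  show ?thesis
  proof (rule that)
    show "norm (- (a /\<^sub>R norm a)) = 1" using ab(1) by simp
    fix z assume "z \<in> Q"
    then have "a \<bullet> x \<le> a \<bullet> z" using ab by force
    then show "- (a /\<^sub>R norm a) \<bullet> z \<le> - (a /\<^sub>R norm a) \<bullet> x"
      by (simp add: mult_left_mono)
  qed
qed

lemma dist_ge_inner_gap:
  assumes "norm u = 1" "u \<bullet> y + e \<le> u \<bullet> z"
  shows "e \<le> dist z y"
proof -
  have "u \<bullet> (z - y) \<le> norm u * norm (z - y)"
    by (rule norm_cauchy_schwarz)
  then show ?thesis
    using assms by (simp add: inner_diff_right dist_norm)
qed

lemma inner_ball_bounds:
  assumes "norm u = 1" "z \<in> ball w e"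
  shows "u \<bullet> w - e \<le> u \<bullet> z"
proof -
  have "u \<bullet> (w - z) \<le> norm u * norm (w - z)"
    by (rule norm_cauchy_schwarz)
  then show ?thesis
    using assms by (simp add: inner_diff_right dist_norm)
qed

text \<open>The ball is the image of \<open>ball c r\<close> under the contraction taking y to (1 -
  t) x + t y, and convexity keeps this image inside P.\<close>

lemma ball_subset_dilation_gap:
  fixes c :: "'a::real_normed_vector"
  assumes "convex P" "ball c r \<subseteq> P" "x \<in> P" "0 < t" "t \<le> 1"
  shows "ball (dilate c (1 - t) x) (t * r) \<subseteq> P"
proof
  fix z assume z: "z \<in> ball (dilate c (1 - t) x) (t * r)"
  define y where "y = c + (z - dilate c (1 - t) x) /\<^sub>R t"
  have "norm (z - dilate c (1 - t) x) < t * r"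
    using z by (simp add: dist_norm norm_minus_commute)
  moreover have "dist c y = norm (z - dilate c (1 - t) x) / t"
    using \<open>0 < t\<close> by (simp add: y_def dist_norm divide_inverse mult.commute)
  ultimately have "dist c y < r"
    using \<open>0 < t\<close> by (simp add: divide_less_eq mult.commute)
  then have "y \<in> P" using assms(2) by auto
  moreover have "z = (1 - t) *\<^sub>R x + t *\<^sub>R y"
    using \<open>0 < t\<close> by (simp add: y_def dilate_def algebra_simps)
  ultimately show "z \<in> P"
    using assms by (auto intro!: convexD)
qed

text \<open>The weak conclusion that smallness of H, V and W have in common. It speaks of whole
  balls since volume does not see a single far point; \<open>\<eta>\<close> serves both as radius
  and as separation.\<close>

definition no_far_balls :: "real \<Rightarrow> 'a::metric_space set \<Rightarrow> 'a set \<Rightarrow> bool" where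
  "no_far_balls \<eta> P Q \<longleftrightarrow> (\<forall>w. ball w \<eta> \<subseteq> P \<longrightarrow> (\<exists>z\<in>ball w \<eta>. \<exists>y\<in>Q. dist z y < \<eta>))"

text \<open>
  If a point of the smaller dilate of \<open>P\<close> is missed by \<open>Q\<close>, a separating half-space there cuts off a ball
  in \<open>P\<close>.  If \<open>Q\<close> has a point outside the larger dilate, its hull with a ball about \<open>c\<close> contains a
  ball far from \<open>P\<close>.
\<close>

lemma sandwiched_if_no_far_balls:
  fixes P Q :: "'a::euclidean_space set"
  assumes P: "convex P" "ball c r \<subseteq> P" and Q: "convex Q"
    and r: "r > 0" and t: "0 < t" "t \<le> 1/2" and \<eta>: "\<eta> = t * r / 8"
    and PQ: "no_far_balls \<eta> P Q" and QP: "no_far_balls \<eta> Q P"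
  shows "sandwiched c t P Q"
proof -
  have tr: "t * r > 0" using t r by simp
  have lower: "dilate c (1 - t) x \<in> Q" if x: "x \<in> P" for x
  proof (rule ccontr)
    let ?x = "dilate c (1 - t) x"
    assume "?x \<notin> Q"
    then obtain u where u: "norm u = 1" "\<And>z. z \<in> Q \<Longrightarrow> u \<bullet> z \<le> u \<bullet> ?x"
      using separating_unit_normal[OF Q] by metis
    \<comment> \<open>The centre is lifted by t * r / 2 = 4 * \<open>\<eta>\<close> above the
      separating hyperplane. After the loss of one radius, the whole ball is still at least
      \<open>\<eta>\<close> away from Q.\<close>
    let ?w = "?x + (t * r / 2) *\<^sub>R u"
    have "ball ?w \<eta> \<subseteq> ball ?x (t * r)"
    proof
      fix z assume "z \<in> ball ?w \<eta>"
      then have "dist ?w z < \<eta>" by simp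
      moreover have "dist ?x ?w = t * r / 2"
        using u(1) tr by (simp add: dist_norm)
      ultimately show "z \<in> ball ?x (t * r)"
        using dist_triangle[of ?x z ?w] tr \<eta> by simp
    qed
    also have "\<dots> \<subseteq> P"
      using ball_subset_dilation_gap[OF P x] t by simp
    finally obtain z y where zy: "z \<in> ball ?w \<eta>" "y \<in> Q" "dist z y < \<eta>"
      using PQ unfolding no_far_balls_def by blast
    have "u \<bullet> ?w = u \<bullet> ?x + t * r / 2"
      using u(1) by (simp add: inner_add_right dot_square_norm)
    then have "u \<bullet> y + \<eta> \<le> u \<bullet> z"
      using inner_ball_bounds[OF u(1) zy(1)] u(2)[OF zy(2)] \<eta> tr by linarith
    then show False
      using dist_ge_inner_gap[OF u(1)] zy(3) by fastforce
  qed
  have upper: "x \<in> dilate c (1 + t) ` P" if x: "x \<in> Q" for x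
  proof (rule ccontr)
    assume a: "x \<notin> dilate c (1 + t) ` P"
    define y where "y = dilate c (1 / (1 + t)) x"
    have xy: "x - c = (1 + t) *\<^sub>R (y - c)"
      using t by (simp add: y_def dilate_def)
    then have "x = dilate c (1 + t) y"
      by (simp add: dilate_def algebra_simps)
    then have "y \<notin> P" using a by blast
    then obtain u where u: "norm u = 1" "\<And>z. z \<in> P \<Longrightarrow> u \<bullet> z \<le> u \<bullet> y"
      using separating_unit_normal[OF P(1)] by metis
    define m where "m = u \<bullet> (y - c)"
    \<comment> \<open>P contains \<open>ball c r\<close>, so a hyperplane with P on one side has
      distance at least r from c. The ball is open, hence the approximation by radii e < r.\<close>
    have m: "m \<ge> r"
    proof (rule dense_le_bounded[OF r])
      fix e assume e: "0 < e" "e < r"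
      then have "c + e *\<^sub>R u \<in> P"
        using P(2) u(1) by (auto simp: subset_iff dist_norm)
      then have "u \<bullet> (c + e *\<^sub>R u) \<le> u \<bullet> y" by (rule u(2))
      then show "e \<le> m"
        using u(1) by (simp add: m_def inner_diff_right inner_add_right dot_square_norm)
    qed
    \<comment> \<open>By \<open>lower\<close>, Q contains the (1 - t)-dilate of
      \<open>ball c r\<close>, and t \<le> 1/2 leaves at least half of the radius.\<close>
    have ballQ: "ball c (r / 2) \<subseteq> Q"
    proof
      fix z assume z: "z \<in> ball c (r / 2)"
      define p where "p = dilate c (1 / (1 - t)) z"
      have "dist c p = dist c z / (1 - t)"
        using t by (simp add: p_def dilate_def dist_norm norm_minus_commute)
      also have "\<dots> < r"
      proof -
        have "dist c z < (1/2) * r" using z by simp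
        also have "\<dots> \<le> (1 - t) * r" using t r by (intro mult_right_mono) auto
        finally show ?thesis using t by (simp add: field_simps)
      qed
      finally have "p \<in> P" using P(2) by auto
      then have "dilate c (1 - t) p \<in> Q" by (rule lower)
      then show "z \<in> Q" using t by (simp add: p_def dilate_def)
    qed
    \<comment> \<open>Pulling x towards c by the fraction t / 4 makes room in Q for a ball of radius
      (t / 4) * (r / 2), which is the origin of \<open>\<eta>\<close> = t * r / 8. It costs less
      than half of the excess t, because (1 - t / 4) * (1 + t) \<ge> 1 + t / 2.\<close>
    let ?w = "dilate c (1 - t / 4) x"
    have "ball ?w (t / 4 * (r / 2)) \<subseteq> Q"
      using ball_subset_dilation_gap[OF Q ballQ x, of "t / 4"] t by simp
    then have "ball ?w \<eta> \<subseteq> Q" by (simp add: \<eta>)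
    then obtain z p where zp: "z \<in> ball ?w \<eta>" "p \<in> P" "dist z p < \<eta>"
      using QP unfolding no_far_balls_def by blast
    have "u \<bullet> ?w = u \<bullet> c + (1 - t / 4) * (1 + t) * m"
      by (simp add: dilate_def xy m_def inner_add_right)
    moreover have "(1 + t / 2) * m \<le> (1 - t / 4) * (1 + t) * m"
    proof (rule mult_right_mono)
      have "t * t \<le> t * (1/2)" using t by (intro mult_left_mono) auto
      moreover have "(1 - t / 4) * (1 + t) = 1 + 3 * t / 4 - t * t / 4" by (simp add: field_simps)
      ultimately show "1 + t / 2 \<le> (1 - t / 4) * (1 + t)" using t by linarith
    qed (use m r in simp)
    moreover have "m + t * r / 2 \<le> (1 + t / 2) * m"
      using m t by (simp add: algebra_simps)
    ultimately have "u \<bullet> ?w \<ge> u \<bullet> c + (m + t * r / 2)" by linarith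
    moreover have "u \<bullet> y = u \<bullet> c + m" by (simp add: m_def inner_diff_right)
    ultimately have "u \<bullet> p + \<eta> \<le> u \<bullet> z"
      using inner_ball_bounds[OF u(1) zp(1)] u(2)[OF zp(2)] \<eta> tr by linarith
    then show False
      using dist_ge_inner_gap[OF u(1)] zp(3) by fastforce
  qed
  show ?thesis
    unfolding sandwiched_def using lower upper by blast
qed

section \<open>Radial homeomorphisms\<close>

definition minkowski_gauge :: "'a::real_vector set \<Rightarrow> 'a \<Rightarrow> real" where
  "minkowski_gauge P x = Inf {s. 0 < s \<and> x /\<^sub>R s \<in> P}"

text \<open>The centre is placed at 0. Openness makes P exactly the strict sublevel set of its
  gauge; the radii r and D compare the gauge with the norm.\<close>

locale gauge_body =
  fixes P :: "'a::euclidean_space set" and r D :: real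
  assumes convex: "convex P" and "open": "open P"
    and ball_subset: "ball 0 r \<subseteq> P" and r_pos: "0 < r"
    and subset_cball: "P \<subseteq> cball 0 D" and D_pos: "0 < D"
begin

abbreviation g where "g \<equiv> minkowski_gauge P"

text \<open>The admissible scales are closed upwards by convexity and form an open set because P is
  open, so they are exactly the numbers strictly above their infimum.\<close>

lemma gauge_less_iff:
  assumes s: "0 < s"
  shows "g x < s \<longleftrightarrow> x /\<^sub>R s \<in> P"
proof -
  define S where "S = {s. 0 < s \<and> x /\<^sub>R s \<in> P}"
  have zero: "0 \<in> P" using ball_subset r_pos by auto
  have bdd: "bdd_below S" by (rule bdd_belowI[of _ 0]) (auto simp: S_def)
  have up: "b \<in> S" if "a \<in> S" "a \<le> b" for a b
  proof -
    have "x /\<^sub>R b = (1 - a / b) *\<^sub>R 0 + (a / b) *\<^sub>R (x /\<^sub>R a)"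
      using that by (simp add: S_def field_simps)
    also have "\<dots> \<in> P"
      using that zero by (intro convexD convex) (auto simp: S_def)
    finally show ?thesis using that by (auto simp: S_def)
  qed
  have ne: "S \<noteq> {}"
  proof -
    \<comment> \<open>The scale (norm x + 1) / r brings x into \<open>ball 0 r\<close>; the summand
      1 keeps it positive for x = 0.\<close>
    have "r * (norm x / (norm x + 1)) < r * 1"
      using r_pos by (intro mult_strict_left_mono) (simp_all add: add_nonneg_pos)
    then have "dist 0 (x /\<^sub>R ((norm x + 1) / r)) < r"
      using r_pos by (simp add: divide_inverse mult_ac)
    then have "(norm x + 1) / r \<in> S"
      using ball_subset r_pos by (auto simp: S_def add_nonneg_pos)
    then show ?thesis by blast
  qed
  have "g x < s \<longleftrightarrow> (\<exists>a\<in>S. a < s)"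
    unfolding minkowski_gauge_def S_def[symmetric] using cInf_less_iff[OF ne bdd] .
  also have "\<dots> \<longleftrightarrow> s \<in> S"
  proof
    assume "s \<in> S"
    have "open ({0<..} \<inter> (\<lambda>a. x /\<^sub>R a) -` P)"
      by (intro continuous_open_preimage "open") (auto intro!: continuous_intros)
    moreover have "S = {0<..} \<inter> (\<lambda>a. x /\<^sub>R a) -` P"
      by (auto simp: S_def)
    ultimately have "open S" by simp
    then obtain e where "e > 0" "ball s e \<subseteq> S"
      using \<open>s \<in> S\<close> openE by blast
    then have "s - e / 2 \<in> S" by (auto simp: dist_real_def)
    then show "\<exists>a\<in>S. a < s" using \<open>e > 0\<close> by force
  qed (use up in force)
  finally show ?thesis using s by (simp add: S_def)
qed

lemma gauge_nonneg: "0 \<le> g x"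
proof -
  define s where "s = max 1 (g x + 1)"
  have "0 < s" "g x < s" by (auto simp: s_def)
  then have "x /\<^sub>R s \<in> P" using gauge_less_iff by blast
  then have "s \<in> {s. 0 < s \<and> x /\<^sub>R s \<in> P}" using \<open>0 < s\<close> by simp
  then show ?thesis
    unfolding minkowski_gauge_def by (intro cInf_greatest) auto
qed

lemma gauge_leI: "(\<And>s. 0 < s \<Longrightarrow> b < s \<Longrightarrow> g x < s) \<Longrightarrow> 0 \<le> b \<Longrightarrow> g x \<le> b"
  by (meson dense_ge le_less_trans less_imp_le)

lemma gauge_scale:
  assumes "0 \<le> k"
  shows "g (k *\<^sub>R x) = k * g x"
proof (cases "k = 0")
  case True
  have "g 0 \<le> 0"
    using ball_subset r_pos by (intro gauge_leI) (auto simp: gauge_less_iff)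
  then show ?thesis using True gauge_nonneg[of 0] by simp
next
  case False
  then have k: "k > 0" using assms by simp
  have iff: "g (k *\<^sub>R x) < s \<longleftrightarrow> k * g x < s" if "s > 0" for s
  proof -
    have "g (k *\<^sub>R x) < s \<longleftrightarrow> g x < s / k"
      using that k by (simp add: gauge_less_iff divide_inverse mult.commute)
    then show ?thesis using k by (simp add: field_simps)
  qed
  show ?thesis
  proof (rule antisym)
    show "g (k *\<^sub>R x) \<le> k * g x"
      using iff gauge_nonneg[of x] k by (intro gauge_leI) auto
    show "k * g x \<le> g (k *\<^sub>R x)"
      using iff gauge_nonneg[of "k *\<^sub>R x"] by (meson dense_ge le_less_trans less_imp_le)
  qed
qed

lemma gauge_zero [simp]: "g 0 = 0"
  using gauge_scale[of 0 0] by simp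

lemma gauge_add: "g (x + y) \<le> g x + g y"
proof (rule gauge_leI)
  fix s assume "g x + g y < s"
  \<comment> \<open>The slack is shared equally to write s = a + b with a and b strictly above the
    two gauges. Then (x + y) / s is the convex combination of x / a and y / b with weights a / s and
    b / s.\<close>
  define e where "e = (s - (g x + g y)) / 2"
  have e: "e > 0" using \<open>g x + g y < s\<close> by (simp add: e_def)
  define a b where "a = g x + e" and "b = g y + e"
  have ab: "0 < a" "0 < b" "a + b = s"
    using e gauge_nonneg[of x] gauge_nonneg[of y] by (auto simp: a_def b_def e_def field_simps)
  have "x /\<^sub>R a \<in> P" "y /\<^sub>R b \<in> P"
    using e ab gauge_less_iff[of a x] gauge_less_iff[of b y] by (auto simp: a_def b_def)
  then have "(a / s) *\<^sub>R (x /\<^sub>R a) + (b / s) *\<^sub>R (y /\<^sub>R b) \<in> P"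
    using ab by (intro convexD convex) (auto simp: add_divide_distrib[symmetric])
  moreover have "(a / s) *\<^sub>R (x /\<^sub>R a) + (b / s) *\<^sub>R (y /\<^sub>R b) = (x + y) /\<^sub>R s"
    using ab by (simp add: scaleR_add_right field_simps)
  ultimately show "g (x + y) < s"
    using ab gauge_less_iff[of s "x + y"] by simp
qed (use gauge_nonneg in \<open>simp add: add_nonneg_nonneg\<close>)

lemma continuous_gauge: "continuous_on UNIV g"
proof (rule convex_on_continuous)
  show "convex_on UNIV g"
  proof (rule convex_onI)
    fix t :: real and x y assume "0 < t" "t < 1"
    then show "g ((1 - t) *\<^sub>R x + t *\<^sub>R y) \<le> (1 - t) * g x + t * g y"
      using gauge_add[of "(1 - t) *\<^sub>R x" "t *\<^sub>R y"] by (simp add: gauge_scale)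
  qed simp
qed simp

lemma gauge_le_norm: "g x \<le> norm x / r"
proof (rule gauge_leI)
  fix s assume "0 < s" "norm x / r < s"
  then show "g x < s"
    using r_pos ball_subset by (auto simp: gauge_less_iff subset_iff field_simps)
qed (use r_pos in simp)

lemma norm_le_gauge: "norm x \<le> D * g x"
proof -
  have "norm x / D \<le> g x"
  proof (rule dense_ge)
    fix s assume "g x < s"
    moreover then have "0 < s" using gauge_nonneg[of x] by simp
    ultimately have "x /\<^sub>R s \<in> P" using gauge_less_iff by simp
    then have "norm (x /\<^sub>R s) \<le> D" using subset_cball by auto
    then show "norm x / D \<le> s" using \<open>0 < s\<close> D_pos by (simp add: field_simps)
  qed
  then show ?thesis using D_pos by (simp add: field_simps)
qed

lemma gauge_pos_iff: "0 < g x \<longleftrightarrow> x \<noteq> 0"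
proof -
  have "0 < g x" if "x \<noteq> 0"
  proof (rule ccontr)
    assume "\<not> 0 < g x"
    then have "g x = 0" using gauge_nonneg[of x] by simp
    then show False using norm_le_gauge[of x] that by simp
  qed
  then show ?thesis by auto
qed

lemma mem_iff_gauge: "x \<in> P \<longleftrightarrow> g x < 1"
  using gauge_less_iff[of 1 x] by simp

end

text \<open>Linear on the segment of each ray inside \<open>{a < 1}\<close> and a translation on the rest of the ray, which
  keeps the displacement bounded.\<close>

definition radial_map :: "('a::real_vector \<Rightarrow> real) \<Rightarrow> ('a \<Rightarrow> real) \<Rightarrow> 'a \<Rightarrow> 'a" where
  "radial_map a b x = (1 + (a x / b x - 1) / max 1 (a x)) *\<^sub>R x"

locale two_gauges = P: gauge_body P r D + Q: gauge_body Q r' D'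
  for P Q :: "'a::euclidean_space set" and r D r' D'
begin

text \<open>A positive factor keeps the image on the same ray, so that \<open>gauge_scale\<close>
  applies and both gauges are multiplied by this one factor.\<close>

lemma factor_pos: "0 < 1 + (P.g x / Q.g x - 1) / max 1 (P.g x)" if "x \<noteq> 0"
proof -
  have "0 < P.g x / Q.g x" using that P.gauge_pos_iff Q.gauge_pos_iff by simp
  then have "- 1 * max 1 (P.g x) < P.g x / Q.g x - 1" by linarith
  then have "- 1 < (P.g x / Q.g x - 1) / max 1 (P.g x)"
    by (subst less_divide_eq) auto
  then show ?thesis by linarith
qed

text \<open>The denominator \<open>max 1 (P.g x)\<close> pays off here: the norm of x is at most D
  times the gauge, so the quotient of the two stays below D even far from the origin, and the
  remaining factor is at most t.\<close>

lemma radial_map_displacement: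
  assumes "0 \<le> t" "\<And>x. (1 - t) * Q.g x \<le> P.g x" "\<And>x. P.g x \<le> (1 + t) * Q.g x"
  shows "dist x (radial_map P.g Q.g x) \<le> t * D"
proof (cases "x = 0")
  case True
  then show ?thesis using assms(1) P.D_pos by (simp add: radial_map_def)
next
  case False
  have "dist x (radial_map P.g Q.g x) = \<bar>P.g x / Q.g x - 1\<bar> * (norm x / max 1 (P.g x))"
    by (simp add: radial_map_def dist_norm scaleR_left_distrib abs_divide)
  moreover have "norm x / max 1 (P.g x) \<le> D"
  proof -
    have "norm x \<le> D * P.g x" by (rule P.norm_le_gauge)
    also have "\<dots> \<le> D * max 1 (P.g x)" using P.D_pos by simp
    finally show ?thesis by (simp add: divide_le_eq)
  qed
  ultimately have "dist x (radial_map P.g Q.g x) \<le> \<bar>P.g x / Q.g x - 1\<bar> * D"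
    using mult_left_mono[OF _ abs_ge_zero] by metis
  also have "\<dots> \<le> t * D"
  proof (rule mult_right_mono)
    have "0 < Q.g x" using False Q.gauge_pos_iff by blast
    then have "P.g x / Q.g x \<le> 1 + t" "1 - t \<le> P.g x / Q.g x"
      using assms(2,3)[of x] by (simp_all add: field_simps)
    then show "\<bar>P.g x / Q.g x - 1\<bar> \<le> t" by linarith
  qed (use P.D_pos in simp)
  finally show ?thesis .
qed

lemma gauge_radial_map: "Q.g (radial_map P.g Q.g x) = (1 + (P.g x / Q.g x - 1) / max 1 (P.g x)) * Q.g x"
proof (cases "x = 0")
  case False
  then show ?thesis unfolding radial_map_def
    using factor_pos[of x] by (intro Q.gauge_scale) simp
qed (simp add: radial_map_def)

lemma gauge_radial_map':
  "P.g (radial_map P.g Q.g x) = (1 + (P.g x / Q.g x - 1) / max 1 (P.g x)) * P.g x"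
proof (cases "x = 0")
  case False
  then show ?thesis unfolding radial_map_def
    using factor_pos[of x] by (intro P.gauge_scale) simp
qed (simp add: radial_map_def)

text \<open>The image of x has gauges k * a and k * b. It satisfies k * b \<le> 1 when a \<le> 1 and
  k * b \<ge> 1 otherwise, so the reversed map uses the matching branch and undoes the scaling or
  the translation along the ray.\<close>

lemma radial_map_inverse: "radial_map Q.g P.g (radial_map P.g Q.g x) = x"
proof (cases "x = 0")
  case False
  define a b where "a = P.g x" and "b = Q.g x"
  have pos: "0 < a" "0 < b" using False P.gauge_pos_iff Q.gauge_pos_iff by (auto simp: a_def b_def)
  define k where "k = 1 + (a / b - 1) / max 1 a"
  have k: "k > 0" using factor_pos[OF False] by (simp add: k_def a_def b_def)
  have "(1 + (k * b / (k * a) - 1) / max 1 (k * b)) * k = 1"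
  proof (cases "a \<le> 1")
    case True
    then have "k = a / b" by (simp add: k_def max_def)
    then show ?thesis using pos True k by (simp add: field_simps max_def)
  next
    case F: False
    then have kb: "k * b = b + 1 - b / a" using pos by (simp add: k_def field_simps max_def)
    have "b * 1 \<ge> b * (1 / a)" using pos F by (intro mult_left_mono) (auto simp: field_simps)
    then have "k * b \<ge> 1" using kb by simp
    then have "(1 + (k * b / (k * a) - 1) / max 1 (k * b)) * k = k + (b / a - 1) / b"
      using k pos by (simp add: max_def field_simps)
    also have "\<dots> = 1" using F pos by (simp add: k_def field_simps max_def)
    finally show ?thesis .
  qed
  then have "(1 + (Q.g (radial_map P.g Q.g x) / P.g (radial_map P.g Q.g x) - 1)
      / max 1 (Q.g (radial_map P.g Q.g x))) * (1 + (P.g x / Q.g x - 1) / max 1 (P.g x)) = 1"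
    unfolding gauge_radial_map gauge_radial_map' by (simp add: k_def a_def b_def)
  then show ?thesis
    unfolding radial_map_def[of Q.g P.g] unfolding radial_map_def[of P.g Q.g x]
    by (metis (no_types, lifting) scaleR_scaleR radial_map_def scaleR_one)
qed (simp add: radial_map_def)

lemma radial_map_mem: "x \<in> P \<Longrightarrow> radial_map P.g Q.g x \<in> Q"
proof (cases "x = 0")
  case False
  assume "x \<in> P"
  then have "P.g x < 1" by (simp add: P.mem_iff_gauge)
  moreover have "Q.g x \<noteq> 0" using False Q.gauge_pos_iff[of x] by simp
  ultimately have "Q.g (radial_map P.g Q.g x) = P.g x"
    by (simp add: gauge_radial_map max_def)
  then show ?thesis using \<open>P.g x < 1\<close> by (simp add: Q.mem_iff_gauge)
qed (simp add: radial_map_def Q.mem_iff_gauge)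

text \<open>At 0 the quotient of the gauges, being constant along rays, need not have a limit. It is
  bounded by D' / r, however, so the map is squeezed to 0 there.\<close>

lemma continuous_radial_map: "continuous_on UNIV (radial_map P.g Q.g)"
  unfolding continuous_on_eq_continuous_at[OF open_UNIV]
proof
  fix x :: 'a
  show "isCont (radial_map P.g Q.g) x"
  proof (cases "x = 0")
    case True
    have "norm (radial_map P.g Q.g y) \<le> (1 + D' / r) * norm y" for y
    proof (cases "y = 0")
      case False
      have "0 < Q.g y" using False Q.gauge_pos_iff by blast
      have "P.g y \<le> (D' * Q.g y) / r"
        using P.gauge_le_norm[of y] divide_right_mono[OF Q.norm_le_gauge[of y], of r] P.r_pos
        by linarith
      then have le: "P.g y / Q.g y \<le> D' / r"
        using \<open>0 < Q.g y\<close> by (simp add: divide_le_eq)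
      have "0 \<le> P.g y / Q.g y"
        using P.gauge_nonneg Q.gauge_nonneg by simp
      then have "(P.g y / Q.g y - 1) / max 1 (P.g y) \<le> (P.g y / Q.g y) / max 1 (P.g y)"
        by (intro divide_right_mono) auto
      also have "\<dots> \<le> (P.g y / Q.g y) / 1"
        using \<open>0 \<le> P.g y / Q.g y\<close> by (intro divide_left_mono) auto
      finally have "(P.g y / Q.g y - 1) / max 1 (P.g y) \<le> D' / r"
        using le by simp
      then have "\<bar>1 + (P.g y / Q.g y - 1) / max 1 (P.g y)\<bar> \<le> 1 + D' / r"
        using factor_pos[OF False] by linarith
      then show ?thesis unfolding radial_map_def norm_scaleR by (rule mult_right_mono) simp
    qed (simp add: radial_map_def)
    then have "\<forall>\<^sub>F y in at 0. norm (radial_map P.g Q.g y) \<le> (1 + D' / r) * norm y"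
      by (rule always_eventually[OF allI])
    moreover have "((\<lambda>y::'a. (1 + D' / r) * norm y) \<longlongrightarrow> 0) (at 0)"
      by (rule tendsto_mult_right_zero[OF tendsto_norm_zero[OF tendsto_ident_at]])
    ultimately have "(radial_map P.g Q.g \<longlongrightarrow> 0) (at 0)"
      by (rule Lim_null_comparison)
    moreover have "radial_map P.g Q.g 0 = 0" by (simp add: radial_map_def)
    ultimately show ?thesis unfolding True isCont_def by simp
  next
    case False
    have "isCont P.g x" "isCont Q.g x"
      using P.continuous_gauge Q.continuous_gauge continuous_on_eq_continuous_at[OF open_UNIV] by auto
    moreover have "Q.g x \<noteq> 0" using False Q.gauge_pos_iff[of x] by auto
    ultimately show ?thesis
      unfolding radial_map_def[abs_def] by (intro continuous_intros) auto
  qed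
qed

end

lemma ex_homeomorphism_gauges:
  assumes "two_gauges P Q r D r' D'" and t: "0 \<le> t"
    and le: "\<And>x. (1 - t) * minkowski_gauge Q x \<le> minkowski_gauge P x"
      "\<And>x. minkowski_gauge P x \<le> (1 + t) * minkowski_gauge Q x"
  shows "\<exists>\<gamma> \<delta>. homeomorphism UNIV UNIV \<gamma> \<delta> \<and> \<gamma> ` P = Q \<and> (\<forall>x. dist x (\<gamma> x) \<le> t * D)"
proof -
  interpret two_gauges P Q r D r' D' by fact
  interpret swap: two_gauges Q P r' D' r D ..
  have "homeomorphism UNIV UNIV (radial_map P.g Q.g) (radial_map Q.g P.g)"
    by (rule homeomorphismI)
       (auto simp: continuous_radial_map swap.continuous_radial_map radial_map_inverse
          swap.radial_map_inverse)
  moreover have "radial_map P.g Q.g ` P = Q"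
  proof
    show "Q \<subseteq> radial_map P.g Q.g ` P"
    proof
      fix y assume "y \<in> Q"
      then show "y \<in> radial_map P.g Q.g ` P"
        using swap.radial_map_mem[of y] swap.radial_map_inverse[of y] by (metis imageI)
    qed
  qed (use radial_map_mem in blast)
  ultimately show ?thesis
    using radial_map_displacement[OF t le] by blast
qed

text \<open>With c moved to the origin, inclusions become reversed inequalities of gauges: the inner
  dilate gives (1 - t) * g_Q \<le> g_P, the outer one g_P \<le> (1 + t) * g_Q. These are the
  hypotheses of \<open>ex_homeomorphism_gauges\<close>.\<close>

lemma homeo_dist_le_sandwiched:
  fixes P Q :: "'a::euclidean_space set"
  assumes P: "convex P" "open P" "ball c r \<subseteq> P" "0 < r" "P \<subseteq> cball c D" "0 < D"
    and Q: "convex Q" "open Q" and t: "0 \<le> t" "t < 1" and sw: "sandwiched c t P Q"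
  shows "homeo_dist P Q \<le> ennreal (t * D)"
proof -
  define P0 Q0 where "P0 = (+) (- c) ` P" and "Q0 = (+) (- c) ` Q"
  have mem: "x \<in> P0 \<longleftrightarrow> c + x \<in> P" "x \<in> Q0 \<longleftrightarrow> c + x \<in> Q" for x
    unfolding P0_def Q0_def by (auto simp: image_iff intro!: bexI[of _ "c + x"])
  have low: "(1 - t) *\<^sub>R x \<in> Q0" if "x \<in> P0" for x
  proof -
    have "dilate c (1 - t) (c + x) \<in> Q"
      using sw that by (auto simp: sandwiched_def mem)
    then show ?thesis by (simp add: dilate_def mem)
  qed
  have upp: "\<exists>y\<in>P0. x = (1 + t) *\<^sub>R y" if "x \<in> Q0" for x
  proof -
    have "c + x \<in> dilate c (1 + t) ` P"
      using sw that mem(2)[of x] unfolding sandwiched_def by blast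
    then obtain y where "c + x = dilate c (1 + t) y" "y \<in> P" by (rule imageE)
    then show ?thesis by (intro bexI[of _ "y - c"]) (auto simp: mem dilate_def)
  qed
  have gP: "gauge_body P0 r D"
  proof
    show "convex P0" unfolding P0_def using P(1) by (rule convex_translation)
    show "open P0" unfolding P0_def using P(2) by (rule open_translation)
    show "ball 0 r \<subseteq> P0"
    proof
      fix x :: 'a assume "x \<in> ball 0 r"
      then have "c + x \<in> ball c r" by (simp add: dist_norm)
      then show "x \<in> P0" using P(3) by (auto simp: mem)
    qed
    show "P0 \<subseteq> cball 0 D"
    proof
      fix x assume "x \<in> P0"
      then have "c + x \<in> cball c D" using P(5) by (auto simp: mem)
      then show "x \<in> cball 0 D" by (simp add: dist_norm)
    qed
  qed (use P in auto)
  then interpret P: gauge_body P0 r D .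
  have gQ: "gauge_body Q0 ((1 - t) * r) ((1 + t) * D)"
  proof
    show "convex Q0" unfolding Q0_def using Q(1) by (rule convex_translation)
    show "open Q0" unfolding Q0_def using Q(2) by (rule open_translation)
    show "ball 0 ((1 - t) * r) \<subseteq> Q0"
    proof
      fix x :: 'a assume "x \<in> ball 0 ((1 - t) * r)"
      then have "x /\<^sub>R (1 - t) \<in> ball 0 r" using t by (simp add: field_simps)
      then have "x /\<^sub>R (1 - t) \<in> P0" using P.ball_subset by blast
      then show "x \<in> Q0" using low[of "x /\<^sub>R (1 - t)"] t by simp
    qed
    show "Q0 \<subseteq> cball 0 ((1 + t) * D)"
    proof
      fix x assume "x \<in> Q0"
      then obtain y where "y \<in> P0" "x = (1 + t) *\<^sub>R y" using upp by blast
      then show "x \<in> cball 0 ((1 + t) * D)" using P.subset_cball t by (auto simp: mult_left_mono)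
    qed
  qed (use P t in auto)
  then interpret Q: gauge_body Q0 "(1 - t) * r" "(1 + t) * D" .
  have "two_gauges P0 Q0 r D ((1 - t) * r) ((1 + t) * D)" ..
  moreover have "(1 - t) * Q.g x \<le> P.g x" for x
  proof -
    have "Q.g x \<le> P.g x / (1 - t)"
    proof (rule Q.gauge_leI)
      fix s assume s: "0 < s" "P.g x / (1 - t) < s"
      then have "P.g x < s * (1 - t)" "0 < s * (1 - t)" using t by (simp_all add: field_simps)
      then have "x /\<^sub>R (s * (1 - t)) \<in> P0" using P.gauge_less_iff by blast
      moreover have "(1 - t) *\<^sub>R (x /\<^sub>R (s * (1 - t))) = x /\<^sub>R s"
        using t s(1) by (simp add: field_simps)
      ultimately show "Q.g x < s"
        using Q.gauge_less_iff[OF s(1)] low by metis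
    qed (use P.gauge_nonneg t in simp)
    then show ?thesis using t by (simp add: field_simps)
  qed
  moreover have "P.g x \<le> (1 + t) * Q.g x" for x
  proof (rule P.gauge_leI)
    fix s assume s: "0 < s" "(1 + t) * Q.g x < s"
    then have "Q.g x < s / (1 + t)" "0 < s / (1 + t)" using t by (simp_all add: field_simps)
    then have "x /\<^sub>R (s / (1 + t)) \<in> Q0" using Q.gauge_less_iff by blast
    then obtain y where y: "y \<in> P0" "x /\<^sub>R (s / (1 + t)) = (1 + t) *\<^sub>R y" using upp by blast
    then have "(1 + t) *\<^sub>R (x /\<^sub>R s) = (1 + t) *\<^sub>R y" by (simp add: divide_inverse mult.commute)
    then have "x /\<^sub>R s = y" by (rule scaleR_left_imp_eq[rotated]) (use t in simp)
    then show "P.g x < s" using y(1) P.gauge_less_iff[OF s(1)] by simp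
  qed (use Q.gauge_nonneg t in simp)
  ultimately obtain \<gamma> \<delta> where \<gamma>: "homeomorphism UNIV UNIV \<gamma> \<delta>" "\<gamma> ` P0 = Q0"
    "\<And>x. dist x (\<gamma> x) \<le> t * D"
    using ex_homeomorphism_gauges[OF _ t(1)] by blast
  \<comment> \<open>Conjugation by the translation back to c leaves every displacement
    unchanged.\<close>
  let ?\<gamma> = "\<lambda>x. c + \<gamma> (x - c)" and ?\<delta> = "\<lambda>x. c + \<delta> (x - c)"
  have cont: "continuous_on UNIV \<gamma>" "continuous_on UNIV \<delta>"
    and inv: "\<And>x. \<gamma> (\<delta> x) = x" "\<And>x. \<delta> (\<gamma> x) = x"
    using \<gamma>(1) by (auto simp: homeomorphism_def)
  have "homeomorphism UNIV UNIV ?\<gamma> ?\<delta>"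
  proof (rule homeomorphismI)
    have shift: "continuous_on UNIV (\<lambda>x. x - c)" by (intro continuous_intros)
    show "continuous_on UNIV ?\<gamma>" "continuous_on UNIV ?\<delta>"
      using continuous_on_compose2[OF cont(1) shift] continuous_on_compose2[OF cont(2) shift]
      by (auto intro: continuous_on_add continuous_on_const)
  qed (auto simp: inv)
  moreover have "?\<gamma> ` P = Q"
  proof -
    have "?\<gamma> ` P = (+) c ` \<gamma> ` P0" by (simp add: P0_def image_image)
    also have "\<dots> = Q" unfolding \<gamma>(2) by (simp add: Q0_def image_image)
    finally show ?thesis .
  qed
  moreover have "(SUP x. ennreal (dist x (?\<gamma> x))) \<le> ennreal (t * D)"
  proof (intro SUP_least ennreal_leI)
    fix x show "dist x (?\<gamma> x) \<le> t * D"
      using \<gamma>(3)[of "x - c"] by (simp add: dist_norm algebra_simps)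
  qed
  ultimately show ?thesis
    unfolding homeo_dist_def by (intro INF_lower2) auto
qed

section \<open>Measure-preserving maps between sets of equal measure\<close>

lemma emeasure_lborel_translate:
  fixes S :: "'a::euclidean_space set"
  assumes "S \<in> sets borel"
  shows "emeasure lborel {x. x + u \<in> S} = emeasure lborel S"
proof -
  have "emeasure lborel S = emeasure (distr lborel borel ((+) u)) S"
    by (simp add: lborel_distr_plus)
  also have "\<dots> = emeasure lborel ((+) u -` S)"
    using assms by (subst emeasure_distr) auto
  also have "(+) u -` S = {x. x + u \<in> S}" by (auto simp: add.commute)
  finally show ?thesis ..
qed

text \<open>The overlaps are bounded by the measure of A, so a finite supremum exists. The factor 2
  avoids asking whether it is attained; if it is 0, any translation will do.\<close>

lemma ex_translation_half_max_overlap: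
  fixes A B :: "'a::euclidean_space set"
  assumes "A \<in> fmeasurable lborel" "B \<in> sets borel"
  shows "\<exists>u. \<forall>v. measure lborel {x\<in>A. x + v \<in> B} \<le> 2 * measure lborel {x\<in>A. x + u \<in> B}"
proof -
  let ?m = "\<lambda>u. measure lborel {x\<in>A. x + u \<in> B}"
  have [measurable]: "A \<in> sets borel" "B \<in> sets borel" using assms by auto
  have "?m u \<le> measure lborel A" for u
  proof (rule measure_mono_fmeasurable)
    have "{x\<in>A. x + u \<in> B} \<in> sets borel" by measurable
    then show "{x\<in>A. x + u \<in> B} \<in> sets lborel" by simp
  qed (use assms in auto)
  then have bdd: "bdd_above (range ?m)" by (intro bdd_aboveI[of _ "measure lborel A"]) auto
  define s where "s = Sup (range ?m)"
  have le: "?m u \<le> s" for u unfolding s_def by (rule cSUP_upper[OF _ bdd]) simp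
  show ?thesis
  proof (cases "s \<le> 0")
    case True
    then have "?m v \<le> 2 * ?m 0" for v
      using le[of v] measure_nonneg[of lborel "{x\<in>A. x + 0 \<in> B}"] by linarith
    then show ?thesis by blast
  next
    case False
    then have "s / 2 < (SUP u. ?m u)" by (simp add: s_def)
    then obtain u where "s / 2 < ?m u"
      using less_cSUP_iff[OF UNIV_not_empty bdd] by blast
    then have "?m v \<le> 2 * ?m u" for v using le[of v] by linarith
    then show ?thesis by blast
  qed
qed

text \<open>After exchanging the integrals, the inner one is, for each x in A, the measure of a
  translate of B. Hence if all overlaps are null, then A or B is null.\<close>

lemma nn_integral_overlap:
  fixes A B :: "'a::euclidean_space set"
  assumes [measurable]: "A \<in> sets borel" "B \<in> sets borel"
  shows "(\<integral>\<^sup>+u. emeasure lborel {x\<in>A. x + u \<in> B} \<partial>lborel) = emeasure lborel A * emeasure lborel B"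
proof -
  have "(\<integral>\<^sup>+u. emeasure lborel {x\<in>A. x + u \<in> B} \<partial>lborel)
      = (\<integral>\<^sup>+u. (\<integral>\<^sup>+x. indicator A x * indicator B (x + u) \<partial>lborel) \<partial>lborel)"
  proof (intro nn_integral_cong)
    fix u
    have "(\<integral>\<^sup>+x. indicator A x * indicator B (x + u) \<partial>lborel)
        = (\<integral>\<^sup>+x. indicator {x\<in>A. x + u \<in> B} x \<partial>lborel)"
      by (intro nn_integral_cong) (auto simp: indicator_def)
    then show "emeasure lborel {x\<in>A. x + u \<in> B}
        = (\<integral>\<^sup>+x. indicator A x * indicator B (x + u) \<partial>lborel)"
      by simp
  qed
  also have "\<dots> = (\<integral>\<^sup>+x. (\<integral>\<^sup>+u. indicator A x * indicator B (x + u) \<partial>lborel) \<partial>lborel)"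
    by (rule lborel_pair.Fubini'[of "\<lambda>x u. indicator A x * indicator B (x + u)"]) measurable
  also have "\<dots> = (\<integral>\<^sup>+x. indicator A x * emeasure lborel B \<partial>lborel)"
  proof (intro nn_integral_cong)
    fix x
    have "(\<integral>\<^sup>+u. indicator A x * indicator B (x + u) \<partial>lborel)
        = indicator A x * (\<integral>\<^sup>+u. indicator B (x + u) \<partial>lborel)"
      by (rule nn_integral_cmult) measurable
    also have "(\<integral>\<^sup>+u. indicator B (x + u) \<partial>lborel) = (\<integral>\<^sup>+u. indicator {u. u + x \<in> B} u \<partial>lborel)"
      by (intro nn_integral_cong) (auto simp: indicator_def add.commute)
    also have "\<dots> = emeasure lborel {u. u + x \<in> B}" by simp
    also have "\<dots> = emeasure lborel B" by (rule emeasure_lborel_translate) simp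
    finally show "(\<integral>\<^sup>+u. indicator A x * indicator B (x + u) \<partial>lborel)
        = indicator A x * emeasure lborel B" .
  qed
  also have "\<dots> = emeasure lborel A * emeasure lborel B"
    by (simp add: nn_integral_multc)
  finally show ?thesis .
qed

text \<open>
  Greedy exhaustion by translations: repeatedly translate part of what is left of \<open>A\<close> into what is
  left of \<open>B\<close>, with an overlap of at least half the supremum.  The overlaps tend to 0, so no translate
  of the final remainder of \<open>A\<close> meets that of \<open>B\<close> in positive measure; by Tonelli the product of
  the two (equal) measures vanishes.
\<close>

lemma ex_measure_preserving_map:
  fixes A B :: "'a::euclidean_space set"
  assumes A: "A \<in> fmeasurable lborel" and B: "B \<in> fmeasurable lborel"
    and eq: "emeasure lborel A = emeasure lborel B"
  shows "\<exists>\<tau>\<in>borel_measurable borel. (\<forall>x. \<tau> x = x \<or> \<tau> x \<in> B) \<and>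
    (\<forall>S\<in>sets borel. emeasure lborel {x\<in>A. \<tau> x \<in> S} = emeasure lborel (B \<inter> S))"
proof -
  \<comment> \<open>The choice is made for arbitrary sets; \<open>half\<close> supplies the
    existence proof for the remainders, which have finite measure.\<close>
  define ch where "ch = (\<lambda>A B :: 'a set. SOME u. \<forall>v. measure lborel {x\<in>A. x + v \<in> B}
      \<le> 2 * measure lborel {x\<in>A. x + u \<in> B})"
  \<comment> \<open>The recursion runs on pairs because each translation depends on both
    remainders.\<close>
  define st where "st = rec_nat (A, B) (\<lambda>_ (A, B).
      (A - {x\<in>A. x + ch A B \<in> B}, B - {y\<in>B. y - ch A B \<in> A}))"
  define R T where "R k = fst (st k)" and "T k = snd (st k)" for k
  define u where "u k = ch (R k) (T k)" for k
  define E F where "E k = {x \<in> R k. x + u k \<in> T k}" and "F k = {y \<in> T k. y - u k \<in> R k}" for k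
  have R0: "R 0 = A" "T 0 = B" by (simp_all add: R_def T_def st_def)
  have RS: "R (Suc k) = R k - E k" "T (Suc k) = T k - F k" for k
    by (simp_all add: R_def T_def E_def F_def u_def st_def split_beta)
  have sub: "R k \<subseteq> A" "T k \<subseteq> B" for k
    by (induction k) (auto simp: R0 RS)
  have [measurable]: "A \<in> sets borel" "B \<in> sets borel" using A B by auto
  have RT [measurable]: "R k \<in> sets borel \<and> T k \<in> sets borel" for k
  proof (induction k)
    case (Suc k)
    then have [measurable]: "R k \<in> sets borel" "T k \<in> sets borel" by auto
    show ?case unfolding RS E_def F_def by measurable
  qed (simp add: R0)
  then have [measurable]: "R k \<in> sets borel" "T k \<in> sets borel" for k by auto
  have [measurable]: "E k \<in> sets borel" "F k \<in> sets borel" for k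
    unfolding E_def F_def by measurable
  have fm: "X \<in> fmeasurable lborel" if "X \<subseteq> A \<or> X \<subseteq> B" "X \<in> sets borel" for X
    using that A B by (auto intro: fmeasurableI2)
  have fin: "emeasure lborel X \<noteq> \<infinity>" if "X \<subseteq> A \<or> X \<subseteq> B" "X \<in> sets borel" for X
    using fm[OF that] by (simp add: fmeasurable_def top.not_eq_extremum)
  have half: "measure lborel {x\<in>R k. x + v \<in> T k} \<le> 2 * measure lborel (E k)" for k v
  proof -
    have "\<exists>u. \<forall>v. measure lborel {x\<in>R k. x + v \<in> T k} \<le> 2 * measure lborel {x\<in>R k. x + u \<in> T k}"
      using fm[of "R k"] sub by (intro ex_translation_half_max_overlap) auto
    from someI_ex[OF this] show ?thesis
      unfolding E_def u_def ch_def by blast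
  qed
  have mono: "R j \<subseteq> R i" "T j \<subseteq> T i" if "i \<le> j" for i j
    using that by (induction j rule: dec_induct) (auto simp: RS)
  have disj: "disjoint_family E" "disjoint_family F"
  proof -
    have "E i \<inter> E j = {}" "F i \<inter> F j = {}" if "i < j" for i j
      using mono[of "Suc i" j] that by (auto simp: RS E_def F_def)
    then show "disjoint_family E" "disjoint_family F"
      unfolding disjoint_family_on_def by (metis inf_commute nat_neq_iff)+
  qed
  have EF: "x \<in> E k \<longleftrightarrow> x + u k \<in> F k" for x k by (auto simp: E_def F_def)
  have vol_piece: "emeasure lborel {x\<in>E k. x + u k \<in> S} = emeasure lborel (F k \<inter> S)"
    if [measurable]: "S \<in> sets borel" for k S
  proof -
    have "{x\<in>E k. x + u k \<in> S} = {x. x + u k \<in> F k \<inter> S}" by (auto simp: EF)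
    then show ?thesis using emeasure_lborel_translate[of "F k \<inter> S" "u k"] by simp
  qed
  have Esub: "E k \<subseteq> A" "F k \<subseteq> B" for k using sub by (auto simp: E_def F_def)
  define A' B' where "A' = A - (\<Union>k. E k)" and "B' = B - (\<Union>k. F k)"
  have [measurable]: "A' \<in> sets borel" "B' \<in> sets borel"
    unfolding A'_def B'_def by measurable
  have sub': "A' \<subseteq> R k" "B' \<subseteq> T k" for k
    by (induction k) (auto simp: A'_def B'_def R0 RS)
  have null: "emeasure lborel A' = 0" "emeasure lborel B' = 0"
  proof -
    \<comment> \<open>The pieces are disjoint and lie in A, which has finite measure. So their
      measures tend to 0, and by \<open>half\<close> they control the overlap for every translation
      v.\<close>
    have "(\<lambda>k. measure lborel (E k)) sums measure lborel (\<Union>k. E k)"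
    proof (rule measure_UNION)
      show "emeasure lborel (\<Union>k. E k) \<noteq> \<infinity>"
        by (rule fin) (use Esub in auto)
    qed (use disj in auto)
    then have lim: "(\<lambda>k. 2 * measure lborel (E k)) \<longlonglongrightarrow> 0"
      by (intro tendsto_mult_right_zero summable_LIMSEQ_zero sums_summable)
    have "emeasure lborel {x\<in>A'. x + v \<in> B'} = 0" for v
    proof -
      have "measure lborel {x\<in>A'. x + v \<in> B'} \<le> 2 * measure lborel (E k)" for k
      proof -
        have [measurable]: "{x\<in>A'. x + v \<in> B'} \<in> sets borel" "{x\<in>R k. x + v \<in> T k} \<in> sets borel"
          by measurable
        have "measure lborel {x\<in>A'. x + v \<in> B'} \<le> measure lborel {x\<in>R k. x + v \<in> T k}"
        proof (rule measure_mono_fmeasurable)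
          show "{x\<in>R k. x + v \<in> T k} \<in> fmeasurable lborel"
            by (rule fm) (use sub in auto)
        qed (use sub' in auto)
        then show ?thesis using half by (rule order_trans)
      qed
      then have "measure lborel {x\<in>A'. x + v \<in> B'} \<le> 0"
        by (intro LIMSEQ_le_const[OF lim]) auto
      then have "measure lborel {x\<in>A'. x + v \<in> B'} = 0"
        using measure_nonneg antisym by blast
      moreover have "emeasure lborel {x\<in>A'. x + v \<in> B'} \<noteq> \<infinity>"
        by (rule fin) (auto simp: A'_def)
      ultimately show ?thesis by (simp add: emeasure_eq_ennreal_measure)
    qed
    then have "emeasure lborel A' * emeasure lborel B' = 0"
      using nn_integral_overlap[of A' B'] by simp
    \<comment> \<open>E k and F k are translates of each other, so equal amounts have been removed
      from the two sets of equal measure.\<close>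
    moreover have "emeasure lborel A' = emeasure lborel B'"
    proof -
      have "emeasure lborel A' = emeasure lborel A - emeasure lborel (\<Union>k. E k)"
        unfolding A'_def using Esub by (intro emeasure_Diff fin) auto
      also have "emeasure lborel (\<Union>k. E k) = (\<Sum>k. emeasure lborel (E k))"
        by (rule suminf_emeasure[symmetric]) (use disj in auto)
      also have "\<dots> = (\<Sum>k. emeasure lborel (F k))"
        using vol_piece[of UNIV] by simp
      also have "\<dots> = emeasure lborel (\<Union>k. F k)"
        by (rule suminf_emeasure) (use disj in auto)
      also have "emeasure lborel A - \<dots> = emeasure lborel B'"
        unfolding B'_def eq using Esub by (intro emeasure_Diff[symmetric] fin) auto
      finally show ?thesis .
    qed
    ultimately show "emeasure lborel A' = 0" "emeasure lborel B' = 0" by auto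
  qed
  \<comment> \<open>The index is unique by disjointness. The identity off the pieces is harmless on
    the null set A', and it makes the bound on displacements in the Wasserstein estimate valid at
    every point.\<close>
  define \<tau> where "\<tau> x = (if \<exists>k. x \<in> E k then x + u (LEAST k. x \<in> E k) else x)" for x
  have \<tau>E: "\<tau> x = x + u k" if "x \<in> E k" for x k
  proof -
    have "j = k" if "x \<in> E j" for j
      using disj(1) that \<open>x \<in> E k\<close> unfolding disjoint_family_on_def by blast
    then have "(LEAST k. x \<in> E k) = k" using \<open>x \<in> E k\<close> by (metis LeastI)
    then show ?thesis using that by (auto simp: \<tau>_def)
  qed
  have \<tau>_meas [measurable]: "\<tau> \<in> borel_measurable borel"
    unfolding \<tau>_def by measurable
  moreover have "\<tau> x = x \<or> \<tau> x \<in> B" for x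
  proof (cases "\<exists>k. x \<in> E k")
    case True
    then obtain k where "x \<in> E k" ..
    then have "\<tau> x \<in> B" using \<tau>E[of x k] EF[of x k] Esub(2)[of k] by auto
    then show ?thesis ..
  qed (simp add: \<tau>_def)
  moreover have "emeasure lborel {x\<in>A. \<tau> x \<in> S} = emeasure lborel (B \<inter> S)"
    if [measurable]: "S \<in> sets borel" for S
  proof -
    have "{x\<in>A. \<tau> x \<in> S} = (\<Union>k. {x\<in>E k. x + u k \<in> S}) \<union> {x\<in>A'. \<tau> x \<in> S}"
      using Esub \<tau>E by (auto simp: A'_def)
    also have "emeasure lborel \<dots> = emeasure lborel (\<Union>k. {x\<in>E k. x + u k \<in> S})"
    proof (rule emeasure_Un_null_set)
      show "{x \<in> A'. \<tau> x \<in> S} \<in> null_sets lborel"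
      proof (rule null_sets_subset)
        show "A' \<in> null_sets lborel" using null by auto
        have "{x \<in> A'. \<tau> x \<in> S} \<in> sets borel" by measurable
        then show "{x \<in> A'. \<tau> x \<in> S} \<in> sets lborel" by simp
      qed auto
      have "(\<Union>k. {x\<in>E k. x + u k \<in> S}) \<in> sets borel" by measurable
      then show "(\<Union>k. {x\<in>E k. x + u k \<in> S}) \<in> sets lborel" by simp
    qed
    also have "\<dots> = (\<Sum>k. emeasure lborel {x\<in>E k. x + u k \<in> S})"
    proof (rule suminf_emeasure[symmetric])
      have "{x\<in>E k. x + u k \<in> S} \<in> sets borel" for k by measurable
      then show "range (\<lambda>k. {x\<in>E k. x + u k \<in> S}) \<subseteq> sets lborel" by auto
      show "disjoint_family (\<lambda>k. {x\<in>E k. x + u k \<in> S})"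
        using disj(1) unfolding disjoint_family_on_def by blast
    qed
    also have "\<dots> = (\<Sum>k. emeasure lborel (F k \<inter> S))" by (simp add: vol_piece)
    also have "\<dots> = emeasure lborel (\<Union>k. F k \<inter> S)"
    proof (rule suminf_emeasure)
      show "disjoint_family (\<lambda>k. F k \<inter> S)"
        using disj(2) unfolding disjoint_family_on_def by blast
    qed auto
    also have "\<dots> = emeasure lborel ((\<Union>k. F k \<inter> S) \<union> (B' \<inter> S))"
    proof (rule emeasure_Un_null_set[symmetric])
      show "B' \<inter> S \<in> null_sets lborel"
        using null by (intro null_set_Int2) auto
    qed auto
    also have "(\<Union>k. F k \<inter> S) \<union> (B' \<inter> S) = B \<inter> S"
      using Esub by (auto simp: B'_def)
    finally show ?thesis .
  qed
  ultimately show ?thesis by (intro bexI[of _ \<tau>]) auto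
qed

section \<open>Volume estimates\<close>

lemma dilate_image_eq:
  fixes c :: "'a::real_vector"
  shows "dilate c s ` P = (\<lambda>x. s *\<^sub>R x + (c - s *\<^sub>R c)) ` P"
  by (intro image_cong) (auto simp: dilate_def algebra_simps)

lemma dilate_dilate: "dilate c a (dilate c b x) = dilate c (a * b) x"
  by (simp add: dilate_def)

lemma dist_dilate: "dist c (dilate c s x) = \<bar>s\<bar> * dist c x"
  for c :: "'a::real_normed_vector"
  by (simp add: dilate_def dist_norm norm_minus_commute)

lemma dilate_1 [simp]: "dilate c 1 x = x"
  by (simp add: dilate_def)

lemma dilate_image_eq_vimage:
  assumes "s \<noteq> 0"
  shows "dilate c s ` P = dilate c (1 / s) -` P"
proof
  show "dilate c s ` P \<subseteq> dilate c (1 / s) -` P"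
    using assms by (auto simp: dilate_dilate)
  show "dilate c (1 / s) -` P \<subseteq> dilate c s ` P"
  proof
    fix x assume "x \<in> dilate c (1 / s) -` P"
    moreover have "x = dilate c s (dilate c (1 / s) x)"
      using assms by (simp add: dilate_dilate)
    ultimately show "x \<in> dilate c s ` P" by blast
  qed
qed

lemma borel_measurable_dilate [measurable]:
  "dilate c s \<in> borel_measurable (borel :: 'a::euclidean_space measure)"
proof -
  have "(\<lambda>x. c + s *\<^sub>R (x - c)) \<in> borel_measurable borel" by measurable
  then show ?thesis by (simp add: dilate_def[abs_def])
qed

lemma borel_dilate_image:
  fixes P :: "'a::euclidean_space set"
  assumes "P \<in> sets borel" "s \<noteq> 0"
  shows "dilate c s ` P \<in> sets borel"
  unfolding dilate_image_eq_vimage[OF assms(2)]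
  using measurable_sets[OF borel_measurable_dilate assms(1)] by simp

lemma measure_dilate_image:
  fixes P :: "'a::euclidean_space set"
  assumes "P \<in> sets borel" "0 < s"
  shows "measure lborel (dilate c s ` P) = s ^ DIM('a) * measure lborel P"
proof -
  have "measure lborel (dilate c s ` P) = measure lebesgue (dilate c s ` P)"
    using borel_dilate_image[OF assms(1)] assms(2) by (simp add: measure_completion)
  also have "\<dots> = s ^ DIM('a) * measure lebesgue P"
    unfolding dilate_image_eq using measure_lebesgue_affine[of s "c - s *\<^sub>R c" P] assms(2) by simp
  also have "measure lebesgue P = measure lborel P"
    using assms(1) by (simp add: measure_completion)
  finally show ?thesis .
qed

lemma dilate_mem:
  fixes P :: "'a::real_vector set"
  assumes "convex P" "c \<in> P" "x \<in> P" "0 \<le> s" "s \<le> 1"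
  shows "dilate c s x \<in> P"
proof -
  have "dilate c s x = (1 - s) *\<^sub>R c + s *\<^sub>R x" by (simp add: dilate_def algebra_simps)
  then show ?thesis using assms by (auto intro!: convexD)
qed

text \<open>P lies between its own dilates. So a sandwiched Q and P are enclosed by the same two
  sets and can differ only in the gap between them.\<close>

lemma sandwiched_refl:
  fixes P :: "'a::real_vector set"
  assumes "convex P" "c \<in> P" "0 \<le> t" "t \<le> 1"
  shows "sandwiched c t P P"
  unfolding sandwiched_def
proof
  show "dilate c (1 - t) ` P \<subseteq> P" using dilate_mem[OF assms(1,2)] assms(3,4) by auto
  show "P \<subseteq> dilate c (1 + t) ` P"
  proof
    fix x assume "x \<in> P"
    then have "dilate c (1 / (1 + t)) x \<in> P" using dilate_mem[OF assms(1,2)] assms(3) by auto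
    moreover have "x = dilate c (1 + t) (dilate c (1 / (1 + t)) x)"
      using assms(3) by (simp add: dilate_dilate)
    ultimately show "x \<in> dilate c (1 + t) ` P" by blast
  qed
qed

section \<open>Convex bodies with explicit centre and radii\<close>

locale convex_body =
  fixes P :: "'a::euclidean_space set" and c :: 'a and r D :: real
  assumes convex: "convex P" and "open": "open P"
    and ball_subset: "ball c r \<subseteq> P" and r_pos: "0 < r"
    and subset_cball: "P \<subseteq> cball c D" and D_pos: "0 < D"
begin

lemma center_mem: "c \<in> P"
  using ball_subset r_pos by auto

lemma borel_body [measurable]: "P \<in> sets borel"
  using "open" by simp

lemma dilate_fmeasurable:
  assumes "0 < s"
  shows "dilate c s ` P \<in> fmeasurable lborel"
proof (rule fmeasurableI2)
  show "cball c (s * D) \<in> fmeasurable lborel"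
    by (intro fmeasurableI emeasure_bounded_finite) auto
  show "dilate c s ` P \<subseteq> cball c (s * D)"
  proof
    fix y assume "y \<in> dilate c s ` P"
    then obtain x where x: "x \<in> P" "y = dilate c s x" by blast
    have "dist c y = s * dist c x" using assms by (simp add: x(2) dist_dilate)
    also have "\<dots> \<le> s * D" using subset_cball x(1) assms by (intro mult_left_mono) auto
    finally show "y \<in> cball c (s * D)" by simp
  qed
  show "dilate c s ` P \<in> sets lborel"
    using borel_dilate_image[OF borel_body] assms by simp
qed

lemma fmeasurable_body: "P \<in> fmeasurable lborel"
  using dilate_fmeasurable[of 1] by simp

lemma measure_pos: "0 < measure lborel P"
proof -
  have "0 < measure lborel (ball c r)" using r_pos by simp
  also have "\<dots> \<le> measure lborel P"
    by (rule measure_mono_fmeasurable[OF ball_subset _ fmeasurable_body]) simp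
  finally show ?thesis .
qed

lemma measure_gap:
  assumes "0 \<le> t" "t < 1"
  shows "measure lborel (dilate c (1 + t) ` P - dilate c (1 - t) ` P)
    = ((1 + t) ^ DIM('a) - (1 - t) ^ DIM('a)) * measure lborel P"
proof -
  have "dilate c (1 - t) ` P \<subseteq> dilate c (1 + t) ` P"
    using sandwiched_refl[OF convex center_mem assms(1)] assms(2)
    unfolding sandwiched_def by (meson less_imp_le order_trans)
  then have "measure lborel (dilate c (1 + t) ` P - dilate c (1 - t) ` P)
      = measure lborel (dilate c (1 + t) ` P) - measure lborel (dilate c (1 - t) ` P)"
    using dilate_fmeasurable[of "1 + t"] dilate_fmeasurable[of "1 - t"] assms
    by (intro measure_Diff) (auto simp: fmeasurable_def)
  then show ?thesis using assms by (simp add: measure_dilate_image left_diff_distrib)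
qed

lemma symdiff_dist_le_sandwiched:
  assumes t: "0 \<le> t" "t < 1" and "sandwiched c t P Q"
  shows "symdiff_dist P Q \<le> ennreal (((1 + t) ^ DIM('a) - (1 - t) ^ DIM('a)) * measure lborel P)"
proof -
  let ?G = "dilate c (1 + t) ` P - dilate c (1 - t) ` P"
  have G: "?G \<in> fmeasurable lborel"
    using dilate_fmeasurable t by (intro fmeasurable.Diff) auto
  have "(P - Q) \<union> (Q - P) \<subseteq> ?G"
    using assms(3) sandwiched_refl[OF convex center_mem, of t] t
    unfolding sandwiched_def by (intro Un_least Diff_mono) simp_all
  then have "symdiff_dist P Q \<le> emeasure lborel ?G"
    unfolding symdiff_dist_def using G by (intro emeasure_mono) auto
  also have "\<dots> = ennreal (measure lborel ?G)"
    using G by (intro emeasure_eq_measure2) auto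
  finally show ?thesis using measure_gap[OF t] by simp
qed

lemma subset_cball_sandwiched:
  assumes "0 \<le> t" "t \<le> 1" "sandwiched c t P Q"
  shows "Q \<subseteq> cball c (2 * D)"
proof
  fix x assume "x \<in> Q"
  moreover have "Q \<subseteq> dilate c (1 + t) ` P"
    using assms(3) by (simp only: sandwiched_def)
  ultimately have "x \<in> dilate c (1 + t) ` P" by (rule rev_subsetD)
  then obtain y where y: "x = dilate c (1 + t) y" "y \<in> P" by (rule imageE)
  have "dist c x = (1 + t) * dist c y"
    using assms by (simp add: y(1) dist_dilate)
  also have "\<dots> \<le> 2 * D"
    using assms y(2) subset_cball by (intro mult_mono) auto
  finally show "x \<in> cball c (2 * D)" by simp
qed

end

lemma convex_region_body:
  fixes P :: "'a::euclidean_space set"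
  assumes "P \<in> convex_regions"
  obtains c r D where "convex_body P c r D"
proof -
  have P: "P \<noteq> {}" "bounded P" "open P" "convex P"
    using assms by (auto simp: convex_regions_def region_def)
  then obtain c where "c \<in> P" by blast
  obtain r where r: "r > 0" "ball c r \<subseteq> P" using P \<open>c \<in> P\<close> openE by blast
  obtain D where D: "\<forall>y\<in>P. dist c y \<le> D" using P(2) bounded_any_center by blast
  then have "P \<subseteq> cball c (max D 1)" by fastforce
  then have "convex_body P c r (max D 1)" using P(3,4) r by (simp add: convex_body_def)
  then show ?thesis by (rule that)
qed

section \<open>Lower bounds for the Hausdorff and the symmetric-difference distance\<close>

lemma no_far_balls_if_hausdorff_less:
  assumes "hausdorff_dist P Q < ennreal \<eta>" "P \<noteq> {}" "Q \<noteq> {}"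
  shows "no_far_balls \<eta> P Q \<and> no_far_balls \<eta> Q P"
proof -
  have "no_far_balls \<eta> A B" if less: "hausdorff_semidist A B < ennreal \<eta>" and "B \<noteq> {}" for A B :: "'a set"
    unfolding no_far_balls_def
  proof (intro allI impI)
    fix w assume w: "ball w \<eta> \<subseteq> A"
    \<comment> \<open>\<open>ennreal\<close> sends nonpositive reals to 0, below which nothing lies.
      Positivity puts the centre w into A, and w alone will witness closeness.\<close>
    have "\<eta> > 0"
    proof (rule ccontr)
      assume "\<not> \<eta> > 0"
      then have "ennreal \<eta> = 0" by (simp add: ennreal_neg)
      then show False using less by simp
    qed
    then have "w \<in> A" using w by auto
    then have "ennreal (infdist w (closure B)) \<le> hausdorff_semidist A B"
      unfolding hausdorff_semidist_def by (rule SUP_upper)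
    then have "ennreal (infdist w (closure B)) < ennreal \<eta>"
      using less by (rule le_less_trans)
    then have "infdist w (closure B) < \<eta>"
      by (simp add: ennreal_less_iff infdist_nonneg)
    moreover have "closure B \<noteq> {}" using \<open>B \<noteq> {}\<close> by simp
    ultimately obtain y' where y': "y' \<in> closure B" "dist w y' < \<eta>"
      using infdist_le2 cINF_less_iff[of "closure B" "dist w" \<eta>] by (auto simp: infdist_notempty)
    then obtain y where "y \<in> B" "dist y y' < \<eta> - dist w y'"
      unfolding closure_approachable by (meson diff_gt_0_iff_gt)
    then have "dist w y < \<eta>" using dist_triangle[of w y y'] by (simp add: dist_commute)
    then show "\<exists>z\<in>ball w \<eta>. \<exists>y\<in>B. dist z y < \<eta>" using \<open>\<eta> > 0\<close> \<open>y \<in> B\<close> \<open>dist w y < \<eta>\<close> by (intro bexI[of _ w] bexI[of _ y]) auto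
  qed
  then show ?thesis using assms by (auto simp: hausdorff_dist_def)
qed

text \<open>A far ball is contained in the symmetric difference, and its volume does not depend on
  its centre.\<close>

lemma no_far_balls_if_symdiff_less:
  fixes P Q :: "'a::euclidean_space set"
  assumes "symdiff_dist P Q < emeasure lborel (ball (0::'a) \<eta>)" "\<eta> > 0"
    and [measurable]: "P \<in> sets borel" "Q \<in> sets borel"
  shows "no_far_balls \<eta> P Q \<and> no_far_balls \<eta> Q P"
proof -
  have "no_far_balls \<eta> A B"
    if AB: "A - B \<subseteq> (P - Q) \<union> (Q - P)" for A B :: "'a set"
  proof (rule ccontr)
    assume "\<not> no_far_balls \<eta> A B"
    then obtain w where w: "ball w \<eta> \<subseteq> A" "\<And>z y. z \<in> ball w \<eta> \<Longrightarrow> y \<in> B \<Longrightarrow> \<not> dist z y < \<eta>"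
      unfolding no_far_balls_def by blast
    have "z \<notin> B" if "z \<in> ball w \<eta>" for z
      using w(2)[OF that, of z] \<open>\<eta> > 0\<close> by auto
    then have "ball w \<eta> \<subseteq> (P - Q) \<union> (Q - P)" using w(1) AB by blast
    then have "emeasure lborel (ball w \<eta>) \<le> symdiff_dist P Q"
      unfolding symdiff_dist_def by (intro emeasure_mono) auto
    moreover have "emeasure lborel (ball w \<eta>) = emeasure lborel (ball (0::'a) \<eta>)"
      using \<open>\<eta> > 0\<close> by (simp add: emeasure_ball)
    ultimately show False using assms(1) by simp
  qed
  then show ?thesis by blast
qed

section \<open>Wasserstein distances\<close>

text \<open>Both Wasserstein bounds compute with real ratios of volumes rather than with
  \<open>ennreal\<close> values of push-forward measures.\<close>

lemma transport_maps_iff: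
  fixes P Q :: "'a::euclidean_space set"
  assumes P: "P \<in> fmeasurable lborel" "0 < measure lborel P"
    and Q: "Q \<in> fmeasurable lborel" "0 < measure lborel Q"
  shows "\<gamma> \<in> transport_maps P Q \<longleftrightarrow> \<gamma> \<in> borel_measurable borel \<and>
    (\<forall>S\<in>sets borel. measure lborel {x\<in>P. \<gamma> x \<in> S} / measure lborel P
      = measure lborel (Q \<inter> S) / measure lborel Q)"
proof -
  have uni: "emeasure (uniform_measure lborel X) S
      = ennreal (measure lborel (X \<inter> S) / measure lborel X)"
    if X: "X \<in> fmeasurable lborel" "0 < measure lborel X" and S: "S \<in> sets borel" for X S :: "'a set"
  proof -
    have "X \<inter> S \<in> fmeasurable lborel"
      using fmeasurable_Int_fmeasurable[OF X(1), of S] S by simp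
    then have "emeasure lborel (X \<inter> S) = ennreal (measure lborel (X \<inter> S))"
      "emeasure lborel X = ennreal (measure lborel X)"
      using X by (simp_all add: emeasure_eq_measure2)
    moreover have "X \<in> sets borel" using X(1) by auto
    ultimately show ?thesis
      using X S by (simp add: divide_ennreal)
  qed
  show ?thesis
  proof (cases "\<gamma> \<in> borel_measurable borel")
    case True
    note [measurable] = True
    have [measurable]: "P \<in> sets borel" using P by auto
    have "distr (uniform_measure lborel P) lborel \<gamma> = uniform_measure lborel Q \<longleftrightarrow>
        (\<forall>S\<in>sets borel. emeasure (distr (uniform_measure lborel P) lborel \<gamma>) S
           = emeasure (uniform_measure lborel Q) S)"
      by (auto intro: measure_eqI)
    also have "\<dots> \<longleftrightarrow> (\<forall>S\<in>sets borel. measure lborel {x\<in>P. \<gamma> x \<in> S} / measure lborel P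
      = measure lborel (Q \<inter> S) / measure lborel Q)"
    proof (intro ball_cong refl)
      fix S :: "'a set" assume [measurable]: "S \<in> sets borel"
      have "emeasure (distr (uniform_measure lborel P) lborel \<gamma>) S
          = emeasure (uniform_measure lborel P) (\<gamma> -` S)"
        using True by (subst emeasure_distr) (auto cong: measurable_cong_sets)
      also have "\<dots> = ennreal (measure lborel (P \<inter> \<gamma> -` S) / measure lborel P)"
        using measurable_sets[OF True, of S] by (intro uni P) simp
      also have "P \<inter> \<gamma> -` S = {x\<in>P. \<gamma> x \<in> S}" by auto
      finally show "(emeasure (distr (uniform_measure lborel P) lborel \<gamma>) S
           = emeasure (uniform_measure lborel Q) S) \<longleftrightarrow>
          (measure lborel {x\<in>P. \<gamma> x \<in> S} / measure lborel P
            = measure lborel (Q \<inter> S) / measure lborel Q)"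
        by (simp add: uni[OF Q])
    qed
    finally show ?thesis using True by (simp add: transport_maps_def)
  qed (simp add: transport_maps_def)
qed

section \<open>Mulholland functions and a lower bound for the Wasserstein distances\<close>

locale mulholland_function =
  fixes \<psi> :: "real \<Rightarrow> real"
  assumes mulholland: "mulholland \<psi>"
begin

abbreviation inv_\<psi> where "inv_\<psi> \<equiv> inv_into {0..} \<psi>"

lemma nonneg: "0 \<le> x \<Longrightarrow> 0 \<le> \<psi> x"
  and continuous: "continuous_on {0..} \<psi>"
  and zero [simp]: "\<psi> 0 = 0"
  and tendsto_top: "filterlim \<psi> at_top at_top"
  using mulholland by (auto simp: mulholland_def image_subset_iff)

lemma strict: "0 \<le> x \<Longrightarrow> x < y \<Longrightarrow> \<psi> x < \<psi> y"
  using mulholland by (auto simp: mulholland_def strict_mono_on_def)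

lemma mono: "0 \<le> x \<Longrightarrow> x \<le> y \<Longrightarrow> \<psi> x \<le> \<psi> y"
  using strict[of x y] by (cases "x = y") auto

lemma pos: "0 < x \<Longrightarrow> 0 < \<psi> x"
  using strict[of 0 x] by simp

text \<open>Divergence to infinity and the intermediate value theorem make \<psi> surjective onto
  the nonnegative reals, so \<open>inv_into\<close> is a true right inverse there.\<close>

lemma
  assumes "0 \<le> y"
  shows inv_nonneg: "0 \<le> inv_\<psi> y" and \<psi>_inv: "\<psi> (inv_\<psi> y) = y"
proof -
  have "\<forall>\<^sub>F x in at_top. y \<le> \<psi> x"
    using tendsto_top by (simp add: filterlim_at_top)
  then obtain b where b: "0 \<le> b" "y \<le> \<psi> b"
    unfolding eventually_at_top_linorder by (meson linorder_linear max.cobounded1 max.cobounded2)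
  have "\<exists>x\<ge>0. x \<le> b \<and> \<psi> x = y"
    using assms b continuous_on_subset[OF continuous, of "{0..b}"] by (intro IVT') auto
  then have "y \<in> \<psi> ` {0..}" by force
  then show "0 \<le> inv_\<psi> y" "\<psi> (inv_\<psi> y) = y"
    using inv_into_into[of y \<psi> "{0..}"] f_inv_into_f[of y \<psi> "{0..}"] by auto
qed

lemma inv_less_iff: "0 \<le> y \<Longrightarrow> 0 < e \<Longrightarrow> inv_\<psi> y < e \<longleftrightarrow> y < \<psi> e"
  using strict[of "inv_\<psi> y" e] mono[of e "inv_\<psi> y"] inv_nonneg \<psi>_inv by (metis less_imp_le not_le)

lemma ex_small:
  assumes "0 < m"
  shows "\<exists>\<delta>>0. \<psi> \<delta> < m"
proof -
  have v: "\<psi> (inv_\<psi> (m / 2)) = m / 2" using assms by (intro \<psi>_inv) simp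
  then have "inv_\<psi> (m / 2) \<noteq> 0" using assms by (metis zero half_gt_zero less_irrefl)
  then have "0 < inv_\<psi> (m / 2)" using inv_nonneg[of "m / 2"] assms by simp
  then show ?thesis using v assms by (intro exI[of _ "inv_\<psi> (m / 2)"]) auto
qed

text \<open>Nothing is known about \<psi> on negative numbers. Precomposition with
  \<open>max 0\<close> yields a function that is continuous everywhere and agrees with \<psi> on the
  values of f.\<close>

lemma borel_measurable_comp:
  assumes [measurable]: "f \<in> borel_measurable M" and "\<And>x. 0 \<le> f x"
  shows "(\<lambda>x. \<psi> (f x)) \<in> borel_measurable M"
proof -
  have "continuous_on UNIV (\<lambda>x::real. \<psi> (max 0 x))"
    by (rule continuous_on_compose2[OF continuous]) (auto intro!: continuous_intros)
  then have [measurable]: "(\<lambda>x. \<psi> (max 0 x)) \<in> borel_measurable borel"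
    by (rule borel_measurable_continuous_onI)
  have "(\<lambda>x. \<psi> (max 0 (f x))) \<in> borel_measurable M" by measurable
  then show ?thesis using assms(2) by (simp add: max_def)
qed

text \<open>Markov's inequality for the transport cost. Integrability has to be established, as the
  Bochner integral would otherwise be 0: almost every point of P lands in Q, so the cost is almost
  everywhere at most \<open>\<psi> K\<close>.\<close>

lemma transport_markov:
  fixes P Q :: "'a::euclidean_space set"
  assumes P: "P \<in> fmeasurable lborel" "0 < measure lborel P" "bounded P"
    and Q: "Q \<in> fmeasurable lborel" "0 < measure lborel Q" "bounded Q"
    and \<gamma>: "\<gamma> \<in> transport_maps P Q" and \<eta>: "0 < \<eta>"
  shows "measure lborel {x\<in>P. \<eta> \<le> dist x (\<gamma> x)} * \<psi> \<eta> \<le> (LINT x:P|lborel. \<psi> (dist x (\<gamma> x)))"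
proof -
  have [measurable]: "\<gamma> \<in> borel_measurable borel" and
    tr: "\<And>S. S \<in> sets borel \<Longrightarrow> measure lborel {x\<in>P. \<gamma> x \<in> S} / measure lborel P
      = measure lborel (Q \<inter> S) / measure lborel Q"
    using \<gamma> transport_maps_iff[OF P(1,2) Q(1,2)] by auto
  have [measurable]: "P \<in> sets borel" "Q \<in> sets borel" using P Q by auto
  let ?N = "{x\<in>P. \<gamma> x \<in> - Q}" and ?B = "{x\<in>P. \<eta> \<le> dist x (\<gamma> x)}"
  have N [measurable]: "?N \<in> sets borel" by measurable
  have B [measurable]: "?B \<in> sets borel" by measurable
  have "measure lborel ?N = 0" using tr[of "- Q"] P by simp
  moreover have "?N \<in> fmeasurable lborel" using P(1) by (rule fmeasurableI2) (use N in auto)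
  ultimately have "?N \<in> null_sets lborel"
    by (simp add: null_sets_def emeasure_eq_measure2 fmeasurableD)
  then have AE: "AE x in lborel. x \<notin> ?N" by (rule AE_not_in)
  have "bounded (P \<union> Q)" using P(3) Q(3) by simp
  then obtain K where K: "\<forall>x\<in>P \<union> Q. \<forall>y\<in>P \<union> Q. dist x y \<le> K"
    unfolding bounded_two_points by (rule exE)
  have \<psi>m [measurable]: "(\<lambda>x. \<psi> (dist x (\<gamma> x))) \<in> borel_measurable borel"
    by (rule borel_measurable_comp) auto
  have int: "integrable lborel (\<lambda>x. indicator P x *\<^sub>R \<psi> (dist x (\<gamma> x)))"
  proof (rule integrableI_bounded_set)
    show "P \<in> sets lborel" "emeasure lborel P < \<infinity>" using P by (auto simp: fmeasurable_def)
    show "AE x in lborel. x \<in> P \<longrightarrow> norm (indicator P x *\<^sub>R \<psi> (dist x (\<gamma> x))) \<le> \<psi> K"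
      using AE
    proof eventually_elim
      case (elim x)
      show ?case
      proof
        assume "x \<in> P"
        then have "dist x (\<gamma> x) \<le> K" using elim K by simp
        then show "norm (indicator P x *\<^sub>R \<psi> (dist x (\<gamma> x))) \<le> \<psi> K"
          using mono[of "dist x (\<gamma> x)" K] nonneg[of "dist x (\<gamma> x)"] \<open>x \<in> P\<close> by simp
      qed
    qed
  qed auto
  have "measure lborel ?B * \<psi> \<eta> = (\<integral>x. indicator ?B x *\<^sub>R \<psi> \<eta> \<partial>lborel)"
    by simp
  also have "\<dots> \<le> (\<integral>x. indicator P x *\<^sub>R \<psi> (dist x (\<gamma> x)) \<partial>lborel)"
  proof (rule integral_mono'[OF int])
    fix x show "indicator ?B x *\<^sub>R \<psi> \<eta> \<le> indicator P x *\<^sub>R \<psi> (dist x (\<gamma> x))"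
      using mono[of \<eta> "dist x (\<gamma> x)"] nonneg[of "dist x (\<gamma> x)"] \<eta> by (auto simp: indicator_def)
    show "0 \<le> indicator P x *\<^sub>R \<psi> (dist x (\<gamma> x))" using nonneg by (simp add: indicator_def)
  qed
  finally show ?thesis by (simp add: set_lebesgue_integral_def)
qed

text \<open>Mass in a ball of P far from Q has to travel at least \<open>\<eta>\<close>, and so has
  the mass that arrives in a ball of Q far from P. The latter is a fraction of the total that
  shrinks with the volume of Q, so this volume must be bounded in terms of P.\<close>

lemma no_far_balls_if_wasserstein_less:
  fixes P :: "'a::euclidean_space set"
  assumes P: "P \<in> fmeasurable lborel" "0 < measure lborel P" "bounded P" and \<eta>: "0 < \<eta>"
  shows "\<exists>\<delta>>0. \<forall>Q. Q \<in> fmeasurable lborel \<and> 0 < measure lborel Q \<and> bounded Q \<and>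
    wasserstein_dist \<psi> P Q < ennreal \<delta> \<longrightarrow> no_far_balls \<eta> P Q \<and> no_far_balls \<eta> Q P"
proof -
  obtain c :: 'a and D where D: "P \<subseteq> cball c D"
    using P(3) bounded_subset_cball by blast
  let ?V = "measure lborel (cball c (D + 1))" and ?b = "measure lborel (ball (0::'a) \<eta>)"
    and ?p = "measure lborel P"
  have b: "0 < ?b" using \<eta> by simp
  have pV: "?p \<le> ?V"
  proof (rule measure_mono_fmeasurable)
    show "cball c (D + 1) \<in> fmeasurable lborel"
      by (intro fmeasurableI emeasure_bounded_finite) auto
  qed (use D P in auto)
  have V: "0 < ?V" using P(2) pV by (rule less_le_trans)
  \<comment> \<open>The three bounds serve, in this order, a far ball in P, the volume of Q, and a
    far ball in Q.\<close>
  define m where "m = min (\<psi> \<eta> * ?b / ?p) (min (\<psi> 1 / 2) (\<psi> \<eta> * ?b / (2 * ?V)))"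
  have "0 < m"
    unfolding m_def min_less_iff_conj using b V pos[OF \<eta>] pos[of 1] P(2)
    by (intro conjI divide_pos_pos mult_pos_pos) auto
  then obtain \<delta> where \<delta>: "0 < \<delta>" "\<psi> \<delta> < m" using ex_small by blast
  have "no_far_balls \<eta> P Q \<and> no_far_balls \<eta> Q P"
    if Q: "Q \<in> fmeasurable lborel" "0 < measure lborel Q" "bounded Q"
      and less: "wasserstein_dist \<psi> P Q < ennreal \<delta>" for Q
  proof -
    let ?q = "measure lborel Q"
    obtain \<gamma> where \<gamma>: "\<gamma> \<in> transport_maps P Q"
      and "ennreal (inv_\<psi> (1 / ?p * (LINT x:P|lborel. \<psi> (dist x (\<gamma> x))))) < ennreal \<delta>"
      using less unfolding wasserstein_dist_def INF_less_iff by blast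
    moreover have "0 \<le> (LINT x:P|lborel. \<psi> (dist x (\<gamma> x)))"
      unfolding set_lebesgue_integral_def
      by (intro integral_nonneg_AE AE_I2 scaleR_nonneg_nonneg indicator_pos_le nonneg zero_le_dist)
    then have I: "0 \<le> 1 / ?p * (LINT x:P|lborel. \<psi> (dist x (\<gamma> x)))" using P(2) by simp
    ultimately have "inv_\<psi> (1 / ?p * (LINT x:P|lborel. \<psi> (dist x (\<gamma> x)))) < \<delta>"
      using inv_nonneg[OF I] by (simp only: ennreal_less_iff)
    then have "1 / ?p * (LINT x:P|lborel. \<psi> (dist x (\<gamma> x))) < m"
      using inv_less_iff[OF I \<delta>(1)] \<delta>(2) by linarith
    then have cost: "(LINT x:P|lborel. \<psi> (dist x (\<gamma> x))) < m * ?p"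
      using P(2) by (simp add: pos_divide_less_eq)
    have [measurable]: "\<gamma> \<in> borel_measurable borel" and
      tr: "\<And>S. S \<in> sets borel \<Longrightarrow> measure lborel {x\<in>P. \<gamma> x \<in> S} / ?p = measure lborel (Q \<inter> S) / ?q"
      using \<gamma> transport_maps_iff[OF P(1,2) Q(1,2)] by auto
    have [measurable]: "P \<in> sets borel" "Q \<in> sets borel" using P(1) Q(1) by auto
    have fm: "X \<in> fmeasurable lborel" if "X \<subseteq> P" "X \<in> sets borel" for X
      using P(1) that(1) by (rule fmeasurableI2) (use that(2) in simp)
    let ?M = "\<lambda>e. {x\<in>P. e \<le> dist x (\<gamma> x)}"
    have M [measurable]: "?M e \<in> sets borel" for e by measurable
    have vimage: "{x\<in>P. \<gamma> x \<in> S} \<in> sets borel" if [measurable]: "S \<in> sets borel" for S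
      by measurable
    have markov: "measure lborel (?M e) < m * ?p / \<psi> e" if "0 < e" for e
      unfolding pos_less_divide_eq[OF pos[OF that]]
      using transport_markov[OF P Q \<gamma> that] cost by (rule le_less_trans)
    have ball_vol: "measure lborel (ball w \<eta>) = ?b" for w :: 'a
      using \<eta> by (simp add: content_ball)
    have "no_far_balls \<eta> P Q"
    proof (rule ccontr)
      assume "\<not> no_far_balls \<eta> P Q"
      then obtain w where w: "ball w \<eta> \<subseteq> P"
        "\<And>z y. z \<in> ball w \<eta> \<Longrightarrow> y \<in> Q \<Longrightarrow> \<not> dist z y < \<eta>"
        unfolding no_far_balls_def by blast
      let ?N = "{x\<in>P. \<gamma> x \<in> - Q}"
      have N [measurable]: "?N \<in> sets borel" by measurable
      have "ball w \<eta> \<subseteq> ?M \<eta> \<union> ?N"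
      proof
        fix x assume "x \<in> ball w \<eta>"
        then show "x \<in> ?M \<eta> \<union> ?N" using w(1) w(2)[of x "\<gamma> x"] by auto
      qed
      then have "?b \<le> measure lborel (?M \<eta> \<union> ?N)"
        unfolding ball_vol[of w, symmetric]
        by (rule measure_mono_fmeasurable) (auto intro!: fm)
      also have "\<dots> \<le> measure lborel (?M \<eta>) + measure lborel ?N"
        by (rule measure_Un_le) auto
      also have "measure lborel ?N = 0" using tr[of "- Q"] P(2) by simp
      finally have "?b < m * ?p / \<psi> \<eta>" using markov[OF \<eta>] by simp
      moreover have "m * ?p \<le> \<psi> \<eta> * ?b / ?p * ?p"
        using P(2) by (intro mult_right_mono) (auto simp: m_def)
      ultimately show False using pos[OF \<eta>] P(2) by (simp add: field_simps)
    qed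
    moreover have "no_far_balls \<eta> Q P"
    proof (rule ccontr)
      assume "\<not> no_far_balls \<eta> Q P"
      then obtain w where w: "ball w \<eta> \<subseteq> Q"
        "\<And>z y. z \<in> ball w \<eta> \<Longrightarrow> y \<in> P \<Longrightarrow> \<not> dist z y < \<eta>"
        unfolding no_far_balls_def by blast
      let ?G = "{x\<in>P. \<gamma> x \<in> ball w \<eta>}"
      have G: "?G \<in> sets borel" by (intro vimage) simp
      have "?b / ?q = measure lborel (Q \<inter> ball w \<eta>) / ?q"
        using w(1) ball_vol[of w] by (simp add: Int_absorb1)
      also have "\<dots> = measure lborel ?G / ?p" by (rule tr[symmetric]) simp
      also have "\<dots> \<le> measure lborel (?M \<eta>) / ?p"
      proof (rule divide_right_mono[OF measure_mono_fmeasurable])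
        show "?G \<subseteq> ?M \<eta>"
        proof
          fix x assume "x \<in> ?G"
          then show "x \<in> ?M \<eta>" using w(2)[of "\<gamma> x" x] by (simp add: dist_commute[of x])
        qed
      qed (use G M in \<open>auto intro!: fm\<close>)
      also have "\<dots> < (m * ?p / \<psi> \<eta>) / ?p"
        using markov[OF \<eta>] P(2) by (rule divide_strict_right_mono)
      finally have "?b / ?q < m / \<psi> \<eta>" using P(2) by simp
      then have bq: "\<psi> \<eta> * ?b < m * ?q"
        using pos[OF \<eta>] Q(2) by (simp add: pos_divide_less_eq pos_less_divide_eq mult.commute)
      \<comment> \<open>At least half of the mass moves by less than 1, so it lands in \<open>cball c (D + 1)\<close>.\<close>
      have q: "?q \<le> 2 * ?V"
      proof -
        let ?H = "{x\<in>P. \<gamma> x \<in> cball c (D + 1)}"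
        have H: "?H \<in> sets borel" by (intro vimage) simp
        have "P \<subseteq> ?M 1 \<union> ?H"
        proof
          fix x assume "x \<in> P"
          then show "x \<in> ?M 1 \<union> ?H"
            using D dist_triangle[of c "\<gamma> x" x] by (cases "1 \<le> dist x (\<gamma> x)") auto
        qed
        then have "?p \<le> measure lborel (?M 1 \<union> ?H)"
          by (rule measure_mono_fmeasurable) (use H M in \<open>auto intro!: fm\<close>)
        also have "\<dots> \<le> measure lborel (?M 1) + measure lborel ?H"
          by (rule measure_Un_le) (use H M in auto)
        also have "measure lborel (?M 1) < m * ?p / \<psi> 1" by (rule markov) simp
        also have "m \<le> \<psi> 1 / 2"
          unfolding m_def by (rule min.coboundedI2[OF min.cobounded1])
        then have "m * ?p / \<psi> 1 \<le> \<psi> 1 / 2 * ?p / \<psi> 1"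
          using pos[of 1] P(2) by (intro divide_right_mono mult_right_mono) auto
        also have "\<psi> 1 / 2 * ?p / \<psi> 1 = ?p / 2" using pos[of 1] by simp
        finally have "1 / 2 \<le> measure lborel ?H / ?p" using P(2) by (simp add: field_simps)
        also have "\<dots> = measure lborel (Q \<inter> cball c (D + 1)) / ?q" by (rule tr) simp
        also have "\<dots> \<le> ?V / ?q"
        proof (rule divide_right_mono[OF measure_mono_fmeasurable])
          show "cball c (D + 1) \<in> fmeasurable lborel"
            by (intro fmeasurableI emeasure_bounded_finite) auto
        qed auto
        finally show ?thesis using Q(2) by (simp add: field_simps)
      qed
      have "m * ?q \<le> \<psi> \<eta> * ?b / (2 * ?V) * (2 * ?V)"
        using q Q(2) V \<open>0 < m\<close> by (intro mult_mono) (auto simp: m_def)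
      then show False using bq V by simp
    qed
    ultimately show ?thesis ..
  qed
  then show ?thesis using \<delta>(1) by blast
qed

end

section \<open>Upper bound for the Wasserstein distances\<close>

lemma ex_volume_matching_dilate:
  fixes P Q :: "'a::euclidean_space set"
  assumes "convex_body P c r D" and Q: "Q \<in> fmeasurable lborel" and t: "0 \<le> t" "t < 1"
    and sw: "sandwiched c t P Q"
  obtains l where "1 - t \<le> l" "l \<le> 1 + t" "measure lborel (dilate c l ` P) = measure lborel Q"
proof -
  interpret convex_body P c r D by fact
  let ?n = "DIM('a)" and ?p = "measure lborel P" and ?q = "measure lborel Q"
  have sub: "dilate c (1 - t) ` P \<subseteq> Q" "Q \<subseteq> dilate c (1 + t) ` P"
    using sw by (simp_all only: sandwiched_def)
  have "measure lborel (dilate c (1 - t) ` P) \<le> ?q"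
    using sub(1) dilate_fmeasurable[of "1 - t"] Q t by (intro measure_mono_fmeasurable) auto
  then have low: "(1 - t) ^ ?n \<le> ?q / ?p"
    using t measure_pos by (simp add: measure_dilate_image pos_le_divide_eq)
  have "?q \<le> measure lborel (dilate c (1 + t) ` P)"
    using sub(2) dilate_fmeasurable[of "1 + t"] Q t by (intro measure_mono_fmeasurable) auto
  then have upp: "?q / ?p \<le> (1 + t) ^ ?n"
    using t measure_pos by (simp add: measure_dilate_image pos_divide_le_eq)
  \<comment> \<open>The solution of l ^ n * vol P = vol Q; the volume bounds given by the sandwich
    pass to l by monotonicity of the root.\<close>
  define l where "l = root ?n (?q / ?p)"
  have n: "0 < ?n" by simp
  have "root ?n ((1 - t) ^ ?n) \<le> l" "l \<le> root ?n ((1 + t) ^ ?n)"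
    unfolding l_def using low upp n by (simp_all only: real_root_le_iff)
  then have l: "1 - t \<le> l" "l \<le> 1 + t" using t by (simp_all add: real_root_power_cancel)
  have "0 \<le> ?q / ?p" by simp
  then have "l ^ ?n = ?q / ?p" unfolding l_def using n by (simp only: real_root_pow_pos2)
  moreover have "measure lborel (dilate c l ` P) = l ^ ?n * ?p"
    using l t by (intro measure_dilate_image) auto
  ultimately have "measure lborel (dilate c l ` P) = ?q" using measure_pos by simp
  with l show ?thesis by (rule that)
qed

context mulholland_function
begin

lemma inv_mono:
  assumes "0 \<le> x" "x \<le> y"
  shows "inv_\<psi> x \<le> inv_\<psi> y"
proof (rule ccontr)
  assume "\<not> ?thesis"
  then have "\<psi> (inv_\<psi> y) < \<psi> (inv_\<psi> x)"
    using assms by (intro strict inv_nonneg) auto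
  then show False using assms \<psi>_inv[of x] \<psi>_inv[of y] by simp
qed

text \<open>The first summand pays for points that are merely dilated, the second for the few whose
  dilate misses Q. Matching volumes make P' - Q and Q - P' equally large, which is what
  \<open>ex_measure_preserving_map\<close> requires.\<close>

lemma wasserstein_dist_le_sandwiched:
  fixes P Q :: "'a::euclidean_space set"
  assumes body: "convex_body P c r D" and Q: "Q \<in> fmeasurable lborel" "0 < measure lborel Q"
    and t: "0 \<le> t" "t \<le> 1 / 2" and sw: "sandwiched c t P Q"
  shows "wasserstein_dist \<psi> P Q \<le> ennreal (inv_\<psi> (\<psi> (t * D)
    + 2 ^ DIM('a) * ((1 + t) ^ DIM('a) - (1 - t) ^ DIM('a)) * \<psi> (3 * D)))"
proof -
  interpret convex_body P c r D by (rule body)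
  let ?n = "DIM('a)" and ?p = "measure lborel P" and ?q = "measure lborel Q"
    and ?g = "(1 + t) ^ DIM('a) - (1 - t) ^ DIM('a)"
  have p: "0 < ?p" by (rule measure_pos)
  have [measurable]: "Q \<in> sets borel" using Q(1) by auto
  have sub: "dilate c (1 - t) ` P \<subseteq> Q" "Q \<subseteq> dilate c (1 + t) ` P"
    using sw by (simp_all only: sandwiched_def)
  obtain l where l: "1 - t \<le> l" "l \<le> 1 + t" and vol: "measure lborel (dilate c l ` P) = ?q"
    using ex_volume_matching_dilate[OF body Q(1) t(1) _ sw] t(2) by force
  have l0: "0 < l" using l t by linarith
  define P' where "P' = dilate c l ` P"
  have P': "P' \<in> fmeasurable lborel" "measure lborel P' = ?q"
    using dilate_fmeasurable[OF l0] vol by (simp_all add: P'_def)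
  then have [measurable]: "P' \<in> sets borel" by auto
  have lp: "l ^ ?n * ?p = ?q"
    using vol measure_dilate_image[OF borel_body l0] by simp
  have mem': "dilate c l x \<in> P' \<longleftrightarrow> x \<in> P" for x
    using l0 by (simp add: P'_def dilate_image_eq_vimage dilate_dilate)
  have pull: "l ^ ?n * measure lborel {x\<in>P. dilate c l x \<in> S} = measure lborel (P' \<inter> S)"
    if [measurable]: "S \<in> sets borel" for S
  proof -
    have s: "{x\<in>P. dilate c l x \<in> S} \<in> sets borel" by measurable
    have "dilate c l ` {x\<in>P. dilate c l x \<in> S} = P' \<inter> S"
      by (auto simp: P'_def)
    then show ?thesis using measure_dilate_image[OF s l0, of c] by simp
  qed
  let ?A = "P' - Q" and ?B = "Q - P'"
  have A: "?A \<in> fmeasurable lborel" and B: "?B \<in> fmeasurable lborel"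
    and I: "P' \<inter> Q \<in> fmeasurable lborel"
    using P' Q by (auto intro: fmeasurable_Diff fmeasurable_Int_fmeasurable)
  have split: "measure lborel (X \<inter> S) = measure lborel (X \<inter> Y \<inter> S) + measure lborel ((X - Y) \<inter> S)"
    if X: "X \<in> fmeasurable lborel" and [measurable]: "Y \<in> sets borel" "S \<in> sets borel" for X Y S :: "'a set"
  proof -
    have [measurable]: "X \<in> sets borel" using X by auto
    have fin: "emeasure lborel (X \<inter> Z) \<noteq> \<infinity>" if "Z \<in> sets borel" for Z
      using fmeasurableD2[OF fmeasurable_Int_fmeasurable[OF X, of Z]] that by simp
    have "X \<inter> S = (X \<inter> (Y \<inter> S)) \<union> (X \<inter> (S - Y))" by blast
    also have "measure lborel \<dots> = measure lborel (X \<inter> (Y \<inter> S)) + measure lborel (X \<inter> (S - Y))"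
      by (intro measure_Union fin) auto
    also have "X \<inter> (Y \<inter> S) = X \<inter> Y \<inter> S" by blast
    also have "X \<inter> (S - Y) = (X - Y) \<inter> S" by blast
    finally show ?thesis .
  qed
  have "measure lborel ?A = measure lborel ?B"
    using split[OF P'(1), of Q UNIV] split[OF Q(1), of P' UNIV] P'(2) by (simp add: Int_commute)
  then have "emeasure lborel ?A = emeasure lborel ?B"
    using A B by (simp add: emeasure_eq_measure2)
  then obtain \<tau> where [measurable]: "\<tau> \<in> borel_measurable borel"
    and \<tau>B: "\<And>x. \<tau> x = x \<or> \<tau> x \<in> ?B"
    and \<tau>S: "\<And>S. S \<in> sets borel \<Longrightarrow> emeasure lborel {x\<in>?A. \<tau> x \<in> S} = emeasure lborel (?B \<inter> S)"
    using ex_measure_preserving_map[OF A B] by blast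
  define \<sigma> where "\<sigma> x = (if x \<in> ?A then \<tau> x else x)" for x
  have [measurable]: "\<sigma> \<in> borel_measurable borel"
    unfolding \<sigma>_def by measurable
  have \<sigma>S: "measure lborel (P' \<inter> \<sigma> -` S) = measure lborel (Q \<inter> S)"
    if [measurable]: "S \<in> sets borel" for S
  proof -
    have v: "\<sigma> -` S \<in> sets borel" using measurable_sets[of \<sigma> borel borel S] by simp
    have "measure lborel (P' \<inter> \<sigma> -` S)
        = measure lborel (P' \<inter> Q \<inter> \<sigma> -` S) + measure lborel (?A \<inter> \<sigma> -` S)"
      using v by (intro split P') auto
    also have "P' \<inter> Q \<inter> \<sigma> -` S = Q \<inter> P' \<inter> S"
      by (auto simp: \<sigma>_def)
    also have "?A \<inter> \<sigma> -` S = {x\<in>?A. \<tau> x \<in> S}"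
      by (auto simp: \<sigma>_def)
    also have "measure lborel {x\<in>?A. \<tau> x \<in> S} = measure lborel (?B \<inter> S)"
      using \<tau>S[of S] by (simp add: measure_def)
    also have "measure lborel (Q \<inter> P' \<inter> S) + measure lborel (?B \<inter> S) = measure lborel (Q \<inter> S)"
      using split[OF Q(1), of P' S] by simp
    finally show ?thesis .
  qed
  define \<gamma> where "\<gamma> x = \<sigma> (dilate c l x)" for x
  have [measurable]: "\<gamma> \<in> borel_measurable borel"
    unfolding \<gamma>_def by measurable
  have "\<gamma> \<in> transport_maps P Q"
  proof (subst transport_maps_iff[OF fmeasurable_body p Q], intro conjI ballI)
    fix S :: "'a set" assume S: "S \<in> sets borel"
    have v: "\<sigma> -` S \<in> sets borel" using measurable_sets[of \<sigma> borel borel S] S by simp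
    have "l ^ ?n * measure lborel {x\<in>P. \<gamma> x \<in> S} = measure lborel (Q \<inter> S)"
      using pull[OF v] \<sigma>S[OF S] by (simp add: \<gamma>_def)
    then show "measure lborel {x\<in>P. \<gamma> x \<in> S} / ?p = measure lborel (Q \<inter> S) / ?q"
      unfolding lp[symmetric] using l0 p by (simp add: field_simps)
  qed simp
  moreover have "1 / ?p * (LINT x:P|lborel. \<psi> (dist x (\<gamma> x)))
      \<le> \<psi> (t * D) + 2 ^ ?n * ?g * \<psi> (3 * D)"
  proof -
    let ?N = "{x\<in>P. dilate c l x \<in> ?A}"
    have N [measurable]: "?N \<in> sets borel" by measurable
    have Nfm: "?N \<in> fmeasurable lborel"
      using fmeasurable_body by (rule fmeasurableI2) (use N in auto)
    \<comment> \<open>\<open>?N\<close> is a preimage under a dilation of factor l \<ge> 1/2, which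
      enlarges volume by at most \<open>2 ^ DIM('a)\<close>.\<close>
    have vN: "measure lborel ?N \<le> 2 ^ ?n * ?g * ?p"
    proof -
      have "(1 / 2) ^ ?n * measure lborel ?N \<le> l ^ ?n * measure lborel ?N"
        using l t by (intro mult_right_mono power_mono) auto
      also have "\<dots> = measure lborel (P' \<inter> ?A)" by (rule pull) measurable
      also have "\<dots> \<le> measure lborel (dilate c (1 + t) ` P - dilate c (1 - t) ` P)"
      proof (rule measure_mono_fmeasurable)
        \<comment> \<open>As l \<le> 1 + t, P' lies in the outer dilate; points outside Q avoid the
          inner one. So P' - Q lies in the gap.\<close>
        have "P' \<subseteq> dilate c (1 + t) ` P"
        proof
          fix x assume "x \<in> P'"
          then obtain y where y: "y \<in> P" "x = dilate c l y" unfolding P'_def by blast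
          have "dilate c (l / (1 + t)) y \<in> P"
            using l t l0 by (intro dilate_mem[OF convex center_mem y(1)]) auto
          moreover have "x = dilate c (1 + t) (dilate c (l / (1 + t)) y)"
            using t by (simp add: y(2) dilate_dilate)
          ultimately show "x \<in> dilate c (1 + t) ` P" by (rule rev_image_eqI)
        qed
        then show "P' \<inter> ?A \<subseteq> dilate c (1 + t) ` P - dilate c (1 - t) ` P"
          using sub(1) by blast
        show "dilate c (1 + t) ` P - dilate c (1 - t) ` P \<in> fmeasurable lborel"
          using dilate_fmeasurable[of "1 + t"] dilate_fmeasurable[of "1 - t"] t
          by (intro fmeasurable_Diff) auto
      qed measurable
      also have "\<dots> = ?g * ?p" using t by (intro measure_gap) auto
      finally show ?thesis by (simp add: power_one_over field_simps)
    qed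
    have near: "dist x (\<gamma> x) \<le> t * D" if "x \<in> P" "x \<notin> ?N" for x
    proof -
      have \<gamma>x: "\<gamma> x = dilate c l x" using that by (auto simp: \<gamma>_def \<sigma>_def)
      have "x - dilate c l x = (1 - l) *\<^sub>R (x - c)"
        by (simp add: dilate_def algebra_simps)
      then have "dist x (\<gamma> x) = norm ((1 - l) *\<^sub>R (x - c))"
        unfolding \<gamma>x dist_norm by (rule arg_cong)
      also have "\<dots> = \<bar>1 - l\<bar> * dist c x" by (simp add: dist_norm norm_minus_commute)
      also have "\<dots> \<le> t * D"
        using l that(1) subset_cball by (intro mult_mono) auto
      finally show ?thesis .
    qed
    \<comment> \<open>P is within D of c. Every image is either in Q or a dilated point of P, hence
      within 2 * D of c, since 1 + t \<le> 2.\<close>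
    have far: "dist x (\<gamma> x) \<le> 3 * D" if "x \<in> P" for x
    proof -
      have "dist c (dilate c l x) = l * dist c x" using l0 by (simp add: dist_dilate)
      also have "\<dots> \<le> 2 * D"
        using l t that subset_cball by (intro mult_mono) auto
      finally have "dilate c l x \<in> cball c (2 * D)" by simp
      moreover have "Q \<subseteq> cball c (2 * D)"
        using t by (intro subset_cball_sandwiched[OF _ _ sw]) auto
      ultimately have "\<gamma> x \<in> cball c (2 * D)"
        using \<tau>B[of "dilate c l x"] by (auto simp: \<gamma>_def \<sigma>_def)
      moreover have "dist c x \<le> D" using that subset_cball by auto
      ultimately show ?thesis
        using dist_triangle3[of x "\<gamma> x" c] by simp
    qed
    have int: "integrable lborel (\<lambda>x. indicator X x *\<^sub>R k)"
      if "X \<in> fmeasurable lborel" for X :: "'a set" and k :: real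
      by (intro integrable_scaleR_left integrable_real_indicator)
         (use that in \<open>auto simp: fmeasurable_def\<close>)
    have "(LINT x:P|lborel. \<psi> (dist x (\<gamma> x)))
        \<le> (\<integral>x. indicator P x *\<^sub>R \<psi> (t * D) + indicator ?N x *\<^sub>R \<psi> (3 * D) \<partial>lborel)"
      unfolding set_lebesgue_integral_def
    proof (rule integral_mono')
      show "integrable lborel (\<lambda>x. indicator P x *\<^sub>R \<psi> (t * D) + indicator ?N x *\<^sub>R \<psi> (3 * D))"
        by (rule Bochner_Integration.integrable_add[OF int[OF fmeasurable_body] int[OF Nfm]])
      fix x
      have nn: "0 \<le> \<psi> (t * D)" "0 \<le> \<psi> (3 * D)" using t D_pos by (auto intro!: nonneg)
      then show "0 \<le> indicator P x *\<^sub>R \<psi> (t * D) + indicator ?N x *\<^sub>R \<psi> (3 * D)"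
        by (simp add: indicator_def)
      show "indicator P x *\<^sub>R \<psi> (dist x (\<gamma> x))
          \<le> indicator P x *\<^sub>R \<psi> (t * D) + indicator ?N x *\<^sub>R \<psi> (3 * D)"
      proof (cases "x \<in> ?N")
        case True
        then show ?thesis using mono[OF _ far[of x]] nn by simp
      next
        case False
        then show ?thesis using mono[OF _ near[of x]] nn by (cases "x \<in> P") (auto simp: indicator_def)
      qed
    qed
    also have "\<dots> = ?p * \<psi> (t * D) + measure lborel ?N * \<psi> (3 * D)"
      by (subst Bochner_Integration.integral_add[OF int[OF fmeasurable_body] int[OF Nfm]]) simp
    also have "\<dots> \<le> ?p * \<psi> (t * D) + 2 ^ ?n * ?g * ?p * \<psi> (3 * D)"
      using vN D_pos by (intro add_left_mono mult_right_mono nonneg) auto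
    also have "\<dots> = (\<psi> (t * D) + 2 ^ ?n * ?g * \<psi> (3 * D)) * ?p"
      by (simp add: distrib_right)
    finally have "(LINT x:P|lborel. \<psi> (dist x (\<gamma> x))) / ?p
        \<le> \<psi> (t * D) + 2 ^ ?n * ?g * \<psi> (3 * D)"
      using p by (simp only: pos_divide_le_eq)
    then show ?thesis by simp
  qed
  moreover have "0 \<le> 1 / ?p * (LINT x:P|lborel. \<psi> (dist x (\<gamma> x)))"
    unfolding set_lebesgue_integral_def
    by (intro mult_nonneg_nonneg integral_nonneg_AE AE_I2 scaleR_nonneg_nonneg indicator_pos_le
        nonneg zero_le_dist) simp
  ultimately show ?thesis
    unfolding wasserstein_dist_def by (intro INF_lower2 ennreal_leI inv_mono)
qed

end

section \<open>Equality of the topologies\<close>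

text \<open>The first distance is at least as fine as the second. Transitivity allows comparisons to
  be chained through \<open>hausdorff_dist\<close>.\<close>

definition dist_refines :: "'p set \<Rightarrow> ('p \<Rightarrow> 'p \<Rightarrow> ennreal) \<Rightarrow> ('p \<Rightarrow> 'p \<Rightarrow> ennreal) \<Rightarrow> bool" where
  "dist_refines C D' D \<longleftrightarrow>
    (\<forall>P\<in>C. \<forall>r>0. \<exists>s>0. \<forall>Q\<in>C. D' P Q < ennreal s \<longrightarrow> D P Q < ennreal r)"

lemma dist_refines_trans:
  assumes "dist_refines C D1 D2" "dist_refines C D2 D3"
  shows "dist_refines C D1 D3"
  unfolding dist_refines_def
proof (intro ballI allI impI)
  fix P and r :: real assume "P \<in> C" "r > 0"
  then obtain s where "s > 0" "\<forall>Q\<in>C. D2 P Q < ennreal s \<longrightarrow> D3 P Q < ennreal r"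
    using assms(2) unfolding dist_refines_def by blast
  moreover then obtain u where "u > 0" "\<forall>Q\<in>C. D1 P Q < ennreal u \<longrightarrow> D2 P Q < ennreal s"
    using assms(1) \<open>P \<in> C\<close> unfolding dist_refines_def by blast
  ultimately show "\<exists>u>0. \<forall>Q\<in>C. D1 P Q < ennreal u \<longrightarrow> D3 P Q < ennreal r"
    by blast
qed

lemma dist_refines_le: "(\<And>P Q. D P Q \<le> D' P Q) \<Longrightarrow> dist_refines C D' D"
  unfolding dist_refines_def by (meson le_less_trans)

lemma dist_topology_eqI:
  assumes "dist_refines C D D'" "dist_refines C D' D"
  shows "dist_topology C D = dist_topology C D'"
proof -
  have "openin (dist_topology C D2) U"
    if "dist_refines C D2 D1" "openin (dist_topology C D1) U" for D1 D2 U
    using that(2)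
    by (rule openin_dist_topology_transfer) (use that(1) in \<open>unfold dist_refines_def, blast\<close>)
  then show ?thesis
    using assms unfolding topology_eq by blast
qed

text \<open>This and \<open>sandwich_small\<close> split each comparison into two halves that
  mention one distance only. Both quantify over all data c, r, R, so that the same centre can be
  used in the two halves.\<close>

definition forces_sandwich :: "('a::euclidean_space set \<Rightarrow> 'a set \<Rightarrow> ennreal) \<Rightarrow> bool" where
  "forces_sandwich D \<longleftrightarrow> (\<forall>P c r R t. convex_body P c r R \<longrightarrow> 0 < t \<longrightarrow> t \<le> 1 / 2 \<longrightarrow>
    (\<exists>s>0. \<forall>Q\<in>convex_regions. D P Q < ennreal s \<longrightarrow> sandwiched c t P Q))"

definition sandwich_small :: "('a::euclidean_space set \<Rightarrow> 'a set \<Rightarrow> ennreal) \<Rightarrow> bool" where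
  "sandwich_small D \<longleftrightarrow> (\<forall>P c r R e. convex_body P c r R \<longrightarrow> 0 < e \<longrightarrow>
    (\<exists>t>0. t \<le> 1 / 2 \<and> (\<forall>Q\<in>convex_regions. sandwiched c t P Q \<longrightarrow> D P Q < ennreal e)))"

lemma dist_refines_sandwich:
  assumes "forces_sandwich D'" "sandwich_small D"
  shows "dist_refines convex_regions D' D"
  unfolding dist_refines_def
proof (intro ballI allI impI)
  fix P :: "'a set" and e :: real assume P: "P \<in> convex_regions" and e: "e > 0"
  obtain c r R where body: "convex_body P c r R" using convex_region_body[OF P] .
  obtain t where "t > 0" "t \<le> 1 / 2"
    "\<forall>Q\<in>convex_regions. sandwiched c t P Q \<longrightarrow> D P Q < ennreal e"
    using assms(2) body e unfolding sandwich_small_def by blast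
  moreover then obtain s where "s > 0"
    "\<forall>Q\<in>convex_regions. D' P Q < ennreal s \<longrightarrow> sandwiched c t P Q"
    using assms(1) body unfolding forces_sandwich_def by blast
  ultimately show "\<exists>s>0. \<forall>Q\<in>convex_regions. D' P Q < ennreal s \<longrightarrow> D P Q < ennreal e"
    by blast
qed

lemma ex_small_at_right:
  fixes h :: "real \<Rightarrow> real"
  assumes "(h \<longlongrightarrow> 0) (at_right 0)" "0 < e"
  shows "\<exists>t>0. t \<le> 1 / 2 \<and> h t < e"
proof -
  have "\<forall>\<^sub>F t in at_right (0::real). 0 < t \<and> t < 1 / 2"
    by (auto simp: eventually_at_right_field intro: exI[of _ "1 / 2"])
  moreover have "\<forall>\<^sub>F t in at_right 0. h t < e"
    using assms by (rule order_tendstoD(2))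
  ultimately have "\<forall>\<^sub>F t in at_right 0. 0 < t \<and> t \<le> 1 / 2 \<and> h t < e"
    by eventually_elim auto
  then show ?thesis using eventually_happens'[OF trivial_limit_at_right_real] by blast
qed

lemma tendsto_gap:
  "((\<lambda>t::real. (1 + t) ^ n - (1 - t) ^ n) \<longlongrightarrow> 0) (at_right 0)"
proof -
  have "((\<lambda>t::real. (1 + t) ^ n - (1 - t) ^ n) \<longlongrightarrow> (1 + 0) ^ n - (1 - 0) ^ n) (at_right 0)"
    by (intro tendsto_intros)
  then show ?thesis by simp
qed

lemma convex_regionD:
  assumes "Q \<in> convex_regions"
  shows "Q \<noteq> {}" "bounded Q" "open Q" "convex Q"
  using assms by (auto simp: convex_regions_def region_def)

section \<open>Small distances force a sandwich\<close>

lemma forces_sandwichI: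
  fixes D :: "'a::euclidean_space set \<Rightarrow> 'a set \<Rightarrow> ennreal"
  assumes "\<And>P c r R \<eta>. convex_body P c r R \<Longrightarrow> 0 < \<eta> \<Longrightarrow>
    \<exists>s>0. \<forall>Q\<in>convex_regions. D P Q < ennreal s \<longrightarrow> no_far_balls \<eta> P Q \<and> no_far_balls \<eta> Q P"
  shows "forces_sandwich D"
  unfolding forces_sandwich_def
proof (intro allI impI)
  fix P and c :: 'a and r R t :: real
  assume body: "convex_body P c r R" and t: "0 < t" "t \<le> 1 / 2"
  interpret convex_body P c r R by (rule body)
  have "0 < t * r / 8" using t r_pos by simp
  from assms[OF body this] obtain s where s: "s > 0"
    "\<And>Q. Q \<in> convex_regions \<Longrightarrow> D P Q < ennreal s \<Longrightarrow>
      no_far_balls (t * r / 8) P Q \<and> no_far_balls (t * r / 8) Q P"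
    by blast
  have "sandwiched c t P Q" if "Q \<in> convex_regions" "D P Q < ennreal s" for Q
    using s(2)[OF that]
    by (intro sandwiched_if_no_far_balls[OF convex ball_subset _ r_pos t refl])
      (auto simp: convex_regionD(4)[OF that(1)])
  then show "\<exists>s>0. \<forall>Q\<in>convex_regions. D P Q < ennreal s \<longrightarrow> sandwiched c t P Q"
    using s(1) by blast
qed

lemma forces_sandwich_hausdorff: "forces_sandwich hausdorff_dist"
proof (rule forces_sandwichI)
  fix P and c :: 'a and r R \<eta> :: real
  assume "convex_body P c r R" "0 < \<eta>"
  then interpret convex_body P c r R by simp
  have "no_far_balls \<eta> P Q \<and> no_far_balls \<eta> Q P"
    if "Q \<in> convex_regions" "hausdorff_dist P Q < ennreal \<eta>" for Q
    using no_far_balls_if_hausdorff_less[OF that(2)] center_mem convex_regionD(1)[OF that(1)] by blast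
  then show "\<exists>s>0. \<forall>Q\<in>convex_regions. hausdorff_dist P Q < ennreal s \<longrightarrow>
      no_far_balls \<eta> P Q \<and> no_far_balls \<eta> Q P"
    using \<open>0 < \<eta>\<close> by blast
qed

lemma forces_sandwich_symdiff: "forces_sandwich symdiff_dist"
proof (rule forces_sandwichI)
  fix P and c :: 'a and r R \<eta> :: real
  assume "convex_body P c r R" and \<eta>: "0 < \<eta>"
  then interpret convex_body P c r R by simp
  define s where "s = measure lborel (ball (0::'a) \<eta>)"
  have "s > 0" using \<eta> by (simp add: s_def)
  have "ball (0::'a) \<eta> \<in> fmeasurable lborel"
    by (intro fmeasurableI emeasure_bounded_finite) auto
  then have s: "ennreal s = emeasure lborel (ball (0::'a) \<eta>)"
    by (simp add: s_def emeasure_eq_measure2)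
  have "no_far_balls \<eta> P Q \<and> no_far_balls \<eta> Q P"
    if "Q \<in> convex_regions" "symdiff_dist P Q < ennreal s" for Q
    using that(2) \<eta> convex_regionD(3)[OF that(1)] unfolding s
    by (intro no_far_balls_if_symdiff_less) auto
  then show "\<exists>s>0. \<forall>Q\<in>convex_regions. symdiff_dist P Q < ennreal s \<longrightarrow>
      no_far_balls \<eta> P Q \<and> no_far_balls \<eta> Q P"
    using \<open>s > 0\<close> by blast
qed

lemma convex_region_measure:
  assumes "Q \<in> convex_regions"
  shows "Q \<in> fmeasurable lborel" "0 < measure lborel Q"
proof -
  obtain c r R where "convex_body Q c r R" using convex_region_body[OF assms] .
  then show "Q \<in> fmeasurable lborel" "0 < measure lborel Q"
    by (simp_all add: convex_body.fmeasurable_body convex_body.measure_pos)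
qed

lemma forces_sandwich_wasserstein:
  assumes "mulholland \<psi>"
  shows "forces_sandwich (wasserstein_dist \<psi>)"
proof (rule forces_sandwichI)
  fix P and c :: 'a and r R \<eta> :: real
  assume "convex_body P c r R" and \<eta>: "0 < \<eta>"
  then interpret convex_body P c r R by simp
  interpret mulholland_function \<psi> by unfold_locales fact
  have "bounded P" using subset_cball bounded_cball bounded_subset by blast
  from no_far_balls_if_wasserstein_less[OF fmeasurable_body measure_pos this \<eta>]
  show "\<exists>s>0. \<forall>Q\<in>convex_regions. wasserstein_dist \<psi> P Q < ennreal s \<longrightarrow>
      no_far_balls \<eta> P Q \<and> no_far_balls \<eta> Q P"
    using convex_region_measure convex_regionD(2) by meson
qed

section \<open>A sandwich forces small distances\<close>

lemma sandwich_smallI: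
  fixes D :: "'a::euclidean_space set \<Rightarrow> 'a set \<Rightarrow> ennreal"
  assumes "\<And>P c r R e. convex_body P c r R \<Longrightarrow> 0 < e \<Longrightarrow> \<exists>h :: real \<Rightarrow> real. (h \<longlongrightarrow> 0) (at_right 0) \<and>
    (\<forall>Q t. Q \<in> convex_regions \<and> 0 < t \<and> t \<le> 1 / 2 \<and> h t < f e \<and> sandwiched c t P Q
      \<longrightarrow> D P Q < ennreal e)"
    and f: "\<And>e. 0 < e \<Longrightarrow> 0 < f e"
  shows "sandwich_small D"
  unfolding sandwich_small_def
proof (intro allI impI)
  fix P and c :: 'a and r R e :: real assume "convex_body P c r R" "0 < e"
  then obtain h :: "real \<Rightarrow> real" where h: "(h \<longlongrightarrow> 0) (at_right 0)"
    "\<forall>Q t. Q \<in> convex_regions \<and> 0 < t \<and> t \<le> 1 / 2 \<and> h t < f e \<and> sandwiched c t P Q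
      \<longrightarrow> D P Q < ennreal e"
    using assms(1) by meson
  obtain t where "t > 0" "t \<le> 1 / 2" "h t < f e"
    using ex_small_at_right[OF h(1) f[OF \<open>0 < e\<close>]] by blast
  then show "\<exists>t>0. t \<le> 1 / 2 \<and> (\<forall>Q\<in>convex_regions. sandwiched c t P Q \<longrightarrow> D P Q < ennreal e)"
    using h(2) by blast
qed

lemma sandwich_small_homeo: "sandwich_small homeo_dist"
proof (rule sandwich_smallI[where f = "\<lambda>e. e"])
  fix P and c :: 'a and r R e :: real assume "convex_body P c r R" and e: "0 < e"
  then interpret convex_body P c r R by simp
  have "((\<lambda>t. t * R) \<longlongrightarrow> 0) (at_right 0)"
    by (rule tendsto_mult_left_zero[OF tendsto_ident_at])
  moreover have "homeo_dist P Q < ennreal e"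
    if "Q \<in> convex_regions" "0 < t" "t \<le> 1 / 2" "t * R < e" "sandwiched c t P Q" for Q t
  proof -
    have "homeo_dist P Q \<le> ennreal (t * R)"
      using that convex_regionD(3,4)[OF that(1)]
      by (intro homeo_dist_le_sandwiched[OF convex "open" ball_subset r_pos subset_cball D_pos]) auto
    also have "\<dots> < ennreal e"
      using that(4) e by (rule ennreal_lessI[rotated])
    finally show ?thesis .
  qed
  ultimately show "\<exists>h. (h \<longlongrightarrow> 0) (at_right 0) \<and> (\<forall>Q t. Q \<in> convex_regions \<and> 0 < t \<and> t \<le> 1 / 2
      \<and> h t < e \<and> sandwiched c t P Q \<longrightarrow> homeo_dist P Q < ennreal e)"
    by (intro exI[of _ "\<lambda>t. t * R"]) blast
qed

lemma sandwich_small_symdiff: "sandwich_small (symdiff_dist :: 'a::euclidean_space set \<Rightarrow> _)"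
proof (rule sandwich_smallI[where f = "\<lambda>e. e"])
  fix P and c :: 'a and r R e :: real assume "convex_body P c r R" and e: "0 < e"
  then interpret convex_body P c r R by simp
  let ?h = "\<lambda>t. ((1 + t) ^ DIM('a) - (1 - t) ^ DIM('a)) * measure lborel P"
  have "(?h \<longlongrightarrow> 0) (at_right 0)"
    by (rule tendsto_mult_left_zero[OF tendsto_gap])
  moreover have "symdiff_dist P Q < ennreal e"
    if "Q \<in> convex_regions" "0 < t" "t \<le> 1 / 2" "?h t < e" "sandwiched c t P Q" for Q t
  proof -
    have "symdiff_dist P Q \<le> ennreal (?h t)"
      using that by (intro symdiff_dist_le_sandwiched) auto
    also have "\<dots> < ennreal e"
      using that(4) e by (rule ennreal_lessI[rotated])
    finally show ?thesis .
  qed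
  ultimately show "\<exists>h. (h \<longlongrightarrow> 0) (at_right 0) \<and> (\<forall>Q t. Q \<in> convex_regions \<and> 0 < t \<and> t \<le> 1 / 2
      \<and> h t < e \<and> sandwiched c t P Q \<longrightarrow> symdiff_dist P Q < ennreal e)"
    by (intro exI[of _ ?h]) blast
qed

lemma sandwich_small_wasserstein:
  assumes "mulholland \<psi>"
  shows "sandwich_small (wasserstein_dist \<psi> :: 'a::euclidean_space set \<Rightarrow> _)"
\<comment> \<open>The estimate bounds the distance by \<open>inv_\<psi>\<close> of a quantity
  tending to 0; that this is below e means that the quantity is below
  \<open>\<psi> e\<close>.\<close>
proof (rule sandwich_smallI[where f = \<psi>])
  interpret mulholland_function \<psi> by unfold_locales fact
  show "0 < \<psi> e" if "0 < e" for e using that by (rule pos)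
  fix P and c :: 'a and r R e :: real assume body: "convex_body P c r R" and e: "0 < e"
  interpret convex_body P c r R by (rule body)
  let ?h = "\<lambda>t. \<psi> (t * R) + 2 ^ DIM('a) * ((1 + t) ^ DIM('a) - (1 - t) ^ DIM('a)) * \<psi> (3 * R)"
  have "(?h \<longlongrightarrow> 0) (at_right 0)"
  proof (rule tendsto_add_zero)
    show "((\<lambda>t. \<psi> (t * R)) \<longlongrightarrow> 0) (at_right 0)"
    proof -
      \<comment> \<open>Continuity of \<psi> is known on {0..} only, so the limit is taken within
        {0..} and then restricted to the right of 0.\<close>
      have "((\<lambda>t. \<psi> (t * R)) \<longlongrightarrow> \<psi> (0 * R)) (at 0 within {0..})"
      proof (rule continuous_on_tendsto_compose[OF continuous])
        show "((\<lambda>t. t * R) \<longlongrightarrow> 0 * R) (at 0 within {0..})" by (intro tendsto_intros)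
        show "\<forall>\<^sub>F t in at 0 within {0..}. t * R \<in> {0..}"
          using D_pos by (auto simp: eventually_at_filter)
      qed simp
      then have "((\<lambda>t. \<psi> (t * R)) \<longlongrightarrow> 0) (at 0 within {0..})" by simp
      then show ?thesis by (rule tendsto_within_subset) auto
    qed
    show "((\<lambda>t. 2 ^ DIM('a) * ((1 + t) ^ DIM('a) - (1 - t) ^ DIM('a)) * \<psi> (3 * R)) \<longlongrightarrow> 0) (at_right 0)"
      by (rule tendsto_mult_left_zero[OF tendsto_mult_right_zero[OF tendsto_gap]])
  qed
  moreover have "wasserstein_dist \<psi> P Q < ennreal e"
    if "Q \<in> convex_regions" "0 < t" "t \<le> 1 / 2" "?h t < \<psi> e" "sandwiched c t P Q" for Q t
  proof -
    have "wasserstein_dist \<psi> P Q \<le> ennreal (inv_\<psi> (?h t))"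
      using that convex_region_measure[OF that(1)]
      by (intro wasserstein_dist_le_sandwiched[OF body]) auto
    also have "\<dots> < ennreal e"
    proof (rule ennreal_lessI[OF e])
      have "(1 - t) ^ DIM('a) \<le> (1 + t) ^ DIM('a)"
        using that by (intro power_mono) auto
      then have "0 \<le> ?h t"
        using that(2) D_pos by (intro add_nonneg_nonneg mult_nonneg_nonneg nonneg) auto
      then show "inv_\<psi> (?h t) < e" using inv_less_iff[OF _ e] that(4) by blast
    qed
    finally show ?thesis .
  qed
  ultimately show "\<exists>h. (h \<longlongrightarrow> 0) (at_right 0) \<and> (\<forall>Q t. Q \<in> convex_regions \<and> 0 < t \<and> t \<le> 1 / 2
      \<and> h t < \<psi> e \<and> sandwiched c t P Q \<longrightarrow> wasserstein_dist \<psi> P Q < ennreal e)"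
    by (intro exI[of _ ?h]) blast
qed

theorem corollary3:
  fixes C :: "'a::euclidean_space set set"
  defines "C \<equiv> convex_regions"
  assumes "DIM('a) \<ge> 2"
  shows "dist_topology C hausdorff_dist = dist_topology C homeo_dist
       \<and> dist_topology C dual_hausdorff_dist = dist_topology C homeo_dist
       \<and> dist_topology C symdiff_dist = dist_topology C homeo_dist
       \<and> (\<forall>\<psi>. mulholland \<psi> \<longrightarrow> dist_topology C (wasserstein_dist \<psi>) = dist_topology C homeo_dist)"
proof -
  have dual: "dist_refines C homeo_dist dual_hausdorff_dist"
    by (rule dist_refines_le) (rule dual_hausdorff_le_homeo)
  have dual_H: "dist_refines C dual_hausdorff_dist hausdorff_dist"
    by (rule dist_refines_le) (rule hausdorff_le_dual)
  have homeo_H: "dist_refines C homeo_dist hausdorff_dist"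
    using dual dual_H by (rule dist_refines_trans)
  have H: "dist_refines C hausdorff_dist D" if "sandwich_small D" for D
    unfolding C_def using forces_sandwich_hausdorff that by (rule dist_refines_sandwich)
  \<comment> \<open>A sandwich is obtained from \<open>homeo_dist\<close> only through
    \<open>hausdorff_dist\<close>, which it dominates; this is why one direction passes through
    \<open>homeo_H\<close>.\<close>
  have eq: "dist_topology C D = dist_topology C homeo_dist"
    if "forces_sandwich D" "sandwich_small D" for D
  proof (rule dist_topology_eqI)
    show "dist_refines C D homeo_dist"
      unfolding C_def using that(1) sandwich_small_homeo by (rule dist_refines_sandwich)
    show "dist_refines C homeo_dist D"
      using homeo_H H[OF that(2)] by (rule dist_refines_trans)
  qed
  have "dist_topology C hausdorff_dist = dist_topology C homeo_dist"
    using H[OF sandwich_small_homeo] homeo_H by (rule dist_topology_eqI)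
  moreover have "dist_topology C dual_hausdorff_dist = dist_topology C homeo_dist"
    using dist_refines_trans[OF dual_H H[OF sandwich_small_homeo]] dual by (rule dist_topology_eqI)
  moreover have "dist_topology C symdiff_dist = dist_topology C homeo_dist"
    by (rule eq[OF forces_sandwich_symdiff sandwich_small_symdiff])
  moreover have "dist_topology C (wasserstein_dist \<psi>) = dist_topology C homeo_dist"
    if "mulholland \<psi>" for \<psi>
    by (rule eq[OF forces_sandwich_wasserstein[OF that] sandwich_small_wasserstein[OF that]])
  ultimately show ?thesis by (intro conjI allI impI)
qed

end
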